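(* If $G$ is a $3$-connected graph with a triangle $T$ and a $K_5$-minor, then $G$ has a $K_5$-minor in which $E(T)$ is the edge-set of a triangle.
   Context: A triangle of a graph is a cycle of length $3$; $E(T)$ is its set of edges. *)

theory Defs
  imports Main
begin

text \<open>
  Graphs are finite and may have loops and parallel edges. Edges are objects of their own, so that
  an edge keeps its identity when other edges are deleted or contracted; this is what gives meaning
  to the edge set of a triangle of G being a set of edges of a minor of G.
\<close>

record ('v, 'e) multigraph =
  vertices :: "'v set"
  edges :: "'e set"
  ends :: "'e \<Rightarrow> 'v set"

definition graph :: "('v, 'e) multigraph \<Rightarrow> bool" where
  "graph G \<longleftrightarrow> finite (vertices G) \<and> finite (edges G) \<and>
     (\<forall>e\<in>edges G. ends G e \<subseteq> vertices G \<and> card (ends G e) \<in> {1, 2})"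

definition subgraph :: "('v, 'e) multigraph \<Rightarrow> ('v, 'e) multigraph \<Rightarrow> bool" where
  "subgraph H G \<longleftrightarrow> graph H \<and> vertices H \<subseteq> vertices G \<and> edges H \<subseteq> edges G \<and>
     (\<forall>e\<in>edges H. ends H e = ends G e)"

definition joined_by :: "('v, 'e) multigraph \<Rightarrow> 'e set \<Rightarrow> ('v \<times> 'v) set" where
  "joined_by G C = {(u, v). \<exists>e\<in>C. ends G e = {u, v}}"

definition connected_graph :: "('v, 'e) multigraph \<Rightarrow> bool" where
  "connected_graph G \<longleftrightarrow> vertices G \<noteq> {} \<and>
     (\<forall>u\<in>vertices G. \<forall>v\<in>vertices G. (u, v) \<in> (joined_by G (edges G))\<^sup>*)"

definition delete_vertices :: "('v, 'e) multigraph \<Rightarrow> 'v set \<Rightarrow> ('v, 'e) multigraph" where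
  "delete_vertices G X =
     \<lparr>vertices = vertices G - X, edges = {e \<in> edges G. ends G e \<inter> X = {}}, ends = ends G\<rparr>"

definition k_connected :: "nat \<Rightarrow> ('v, 'e) multigraph \<Rightarrow> bool" where
  "k_connected k G \<longleftrightarrow> card (vertices G) > k \<and>
     (\<forall>X\<subseteq>vertices G. card X < k \<longrightarrow> connected_graph (delete_vertices G X))"

definition is_cycle :: "nat \<Rightarrow> ('v, 'e) multigraph \<Rightarrow> bool" where
  "is_cycle n G \<longleftrightarrow> n \<ge> 1 \<and>
     (\<exists>vs es. length vs = n \<and> length es = n \<and> distinct vs \<and> distinct es \<and>
        vertices G = set vs \<and> edges G = set es \<and>
        (\<forall>i<n. ends G (es ! i) = {vs ! i, vs ! (Suc i mod n)}))"

definition triangle :: "('v, 'e) multigraph \<Rightarrow> ('v, 'e) multigraph \<Rightarrow> bool" where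
  "triangle T G \<longleftrightarrow> subgraph T G \<and> is_cycle 3 T"

definition component :: "('v, 'e) multigraph \<Rightarrow> 'e set \<Rightarrow> 'v \<Rightarrow> 'v set" where
  "component G C v = {w \<in> vertices G. (v, w) \<in> (joined_by G C)\<^sup>*}"

text \<open>
  In G/C every component of the spanning subgraph of G with edge set C becomes one vertex. An edge
  outside C with both ends in one component becomes a loop; parallel edges are kept.
\<close>

definition contract :: "('v, 'e) multigraph \<Rightarrow> 'e set \<Rightarrow> ('v set, 'e) multigraph" where
  "contract G C =
     \<lparr>vertices = component G C ` vertices G, edges = edges G - C,
      ends = (\<lambda>e. component G C ` ends G e)\<rparr>"

text \<open>A minor is obtained by deleting vertices and edges and contracting edges.\<close>

definition minor :: "('v set, 'e) multigraph \<Rightarrow> ('v, 'e) multigraph \<Rightarrow> bool" where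
  "minor N G \<longleftrightarrow> (\<exists>H C. subgraph H G \<and> C \<subseteq> edges H \<and> N = contract H C)"

definition isomorphic :: "('v, 'e) multigraph \<Rightarrow> ('w, 'f) multigraph \<Rightarrow> bool" where
  "isomorphic G H \<longleftrightarrow>
     (\<exists>f g. bij_betw f (vertices G) (vertices H) \<and> bij_betw g (edges G) (edges H) \<and>
        (\<forall>e\<in>edges G. ends H (g e) = f ` ends G e))"

definition complete_graph :: "nat \<Rightarrow> (nat, nat set) multigraph" where
  "complete_graph n =
     \<lparr>vertices = {..<n}, edges = {e. e \<subseteq> {..<n} \<and> card e = 2}, ends = (\<lambda>e. e)\<rparr>"

end

theory Submission
  imports Defs
begin

text \<open>
  Call a set \<open>Z\<close> tied to a clique model if no separation of order less than \<open>|Z|\<close> has \<open>Z\<close> on one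
  side and a whole branch set strictly on the other. A \<open>K\<^sub>5\<close>-model that is tied to a triangle \<open>Z\<close> can
  be changed so that the vertices of \<open>Z\<close> lie in distinct branch sets, by induction on the number of
  vertices. If contracting an edge that preserves the model and \<open>Z\<close> destroys tiedness, then there is a
  separation \<open>(P, Q)\<close> of order 3 with \<open>Z \<subset> P\<close> and a branch set in \<open>Q - P\<close>; apply the induction
  hypothesis to \<open>Q\<close> with \<open>P \<inter> Q\<close> made a triangle, and use Menger's theorem in \<open>P\<close> to link \<open>Z\<close> to
  \<open>P \<inter> Q\<close>. If no edge can be contracted, every branch set is a single vertex or a subset of \<open>Z\<close>, and
  a matching from \<open>Z\<close> into the remaining vertices yields the new model explicitly.
\<close>

section \<open>Connected sets, separations and contractions\<close>

text \<open>Tiedness replaces 3-connectedness because the latter need not survive contracting an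
  edge or passing to one side of a separation; in a 3-connected graph every clique model is tied to
  every triangle. Contracting \<open>uv\<close> lowers the order of a separation by at most one, and
  only if \<open>u\<close> and \<open>v\<close> both lie in the separator, so losing tiedness yields
  order exactly 3 with the vertex \<open>v\<close> outside \<open>Z\<close> in the separator. Hence
  \<open>P \<noteq> Z\<close>, which makes \<open>Q\<close> smaller than the whole graph. The edges
  added on \<open>P \<inter> Q\<close> are fictitious, but a rooted model can give them up: inside a
  branch set they are loops, and between two branch sets an edge of the triangle \<open>Z\<close> at
  the far ends of the linkage takes over. The number 5 enters twice: five disjoint branch sets
  cannot all meet a set of three roots, and in the irreducible case a branch set with two roots
  leaves at least three singletons off \<open>Z\<close>, enough for a matching. Rootedness suffices
  for the minor: the triangle edges then join three different pairs of branch sets and may be chosen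
  to represent these adjacencies.\<close>

text \<open>Connectedness is phrased by cuts, which pull back along contractions more easily than paths.\<close>

definition conn :: "('a \<times> 'a) set \<Rightarrow> 'a set \<Rightarrow> bool" where
  "conn E B \<longleftrightarrow> B \<noteq> {} \<and> (\<forall>S. S \<subset> B \<longrightarrow> S \<noteq> {} \<longrightarrow> (\<exists>x\<in>S. \<exists>y\<in>B - S. (x, y) \<in> E))"

definition separation :: "('a \<times> 'a) set \<Rightarrow> 'a set \<Rightarrow> 'a set \<Rightarrow> 'a set \<Rightarrow> bool" where
  "separation E V P Q \<longleftrightarrow> P \<union> Q = V \<and> (\<forall>x\<in>P - Q. \<forall>y\<in>Q - P. (x, y) \<notin> E)"

text \<open>The contracted edge keeps the name \<open>u\<close>, so the smaller graph lives on
  \<open>V - {v}\<close> in the same type and an induction over all graphs of that type applies to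
  it.\<close>

definition collapse :: "'a \<Rightarrow> 'a \<Rightarrow> 'a \<Rightarrow> 'a" where
  "collapse u v x = (if x = v then u else x)"

definition collapse_rel :: "'a \<Rightarrow> 'a \<Rightarrow> ('a \<times> 'a) set \<Rightarrow> ('a \<times> 'a) set" where
  "collapse_rel u v E = map_prod (collapse u v) (collapse u v) ` E"

lemma connD:
  assumes "conn E B" "S \<subset> B" "S \<noteq> {}"
  obtains x y where "x \<in> S" "y \<in> B - S" "(x, y) \<in> E"
  using assms unfolding conn_def by blast

lemma conn_nonempty: "conn E B \<Longrightarrow> B \<noteq> {}"
  by (simp add: conn_def)

lemma conn_singleton [simp]: "conn E {x}"
  by (auto simp: conn_def)

text \<open>Loops never cross a cut. Exempting them makes it possible to drop the edges of a clique
  that \<open>B\<close> meets in a single vertex.\<close>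

lemma conn_mono:
  assumes "conn E B" "\<And>x y. (x, y) \<in> E \<Longrightarrow> x \<in> B \<Longrightarrow> y \<in> B \<Longrightarrow> x \<noteq> y \<Longrightarrow> (x, y) \<in> F"
  shows "conn F B"
  unfolding conn_def
proof (intro conjI allI impI)
  show "B \<noteq> {}" using assms(1) by (rule conn_nonempty)
  fix S assume S: "S \<subset> B" "S \<noteq> {}"
  obtain x y where "x \<in> S" "y \<in> B - S" "(x, y) \<in> E" by (rule connD[OF assms(1) S])
  then show "\<exists>x\<in>S. \<exists>y\<in>B - S. (x, y) \<in> F" using assms(2) S by blast
qed

lemma conn_join:
  assumes "sym E" "conn E B" "conn E C" "x \<in> B" "y \<in> C" "x = y \<or> (x, y) \<in> E"
  shows "conn E (B \<union> C)"
  unfolding conn_def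
proof (intro conjI allI impI)
  show "B \<union> C \<noteq> {}" using assms(4) by auto
  fix S assume S: "S \<subset> B \<union> C" "S \<noteq> {}"
  consider "S \<inter> B \<noteq> {}" "S \<inter> B \<subset> B" | "S \<inter> C \<noteq> {}" "S \<inter> C \<subset> C"
    | "S = B" "S \<inter> C = {}" | "S = C" "S \<inter> B = {}"
    using S by blast
  then show "\<exists>x\<in>S. \<exists>y\<in>B \<union> C - S. (x, y) \<in> E"
  proof cases
    case 1
    then show ?thesis using connD[OF assms(2), of "S \<inter> B"] by (metis DiffD1 DiffD2 DiffI IntD1 IntI UnI1)
  next
    case 2
    then show ?thesis using connD[OF assms(3), of "S \<inter> C"] by (metis DiffD1 DiffD2 DiffI IntD1 IntI UnI2)
  next
    case 3
    then show ?thesis using assms(4,5,6) by blast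
  next
    case 4
    then show ?thesis using assms(4,5,6) symD[OF assms(1)] by blast
  qed
qed

lemma conn_pair: "sym E \<Longrightarrow> (x, y) \<in> E \<Longrightarrow> conn E {x, y}"
  using conn_join[of E "{x}" "{y}" x y] by (simp add: insert_commute)

text \<open>A cut that does not split \<open>B\<close> has all of \<open>B\<close> on one side; a
  vertex on the other side then lies in some \<open>D\<close>, which meets \<open>B\<close> and is
  therefore split.\<close>

lemma conn_absorb:
  assumes "conn E B" "\<forall>D\<in>\<D>. conn E D \<and> D \<inter> B \<noteq> {}" "sym E"
  shows "conn E (B \<union> \<Union>\<D>)"
  unfolding conn_def
proof (intro conjI allI impI)
  show "B \<union> \<Union>\<D> \<noteq> {}" using conn_nonempty[OF assms(1)] by auto
  fix S assume S: "S \<subset> B \<union> \<Union>\<D>" "S \<noteq> {}"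
  show "\<exists>x\<in>S. \<exists>y\<in>B \<union> \<Union>\<D> - S. (x, y) \<in> E"
  proof (cases "S \<inter> B \<noteq> {} \<and> S \<inter> B \<subset> B")
    case True
    then show ?thesis using connD[OF assms(1), of "S \<inter> B"] by (metis DiffD1 DiffD2 DiffI IntD1 IntI UnI1)
  next
    case False
    then consider "S \<inter> B = {}" | "B \<subseteq> S" by blast
    then obtain D where D: "D \<in> \<D>" "S \<inter> D \<noteq> {}" "S \<inter> D \<subset> D"
    proof cases
      case 1
      then obtain x D where "x \<in> S" "D \<in> \<D>" "x \<in> D" using S by blast
      then show ?thesis using that[of D] 1 assms(2) by blast
    next
      case 2
      then obtain x D where "x \<notin> S" "D \<in> \<D>" "x \<in> D" using S by blast
      then show ?thesis using that[of D] 2 assms(2) by blast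
    qed
    then have "conn E D" using assms(2) by blast
    then obtain x y where "x \<in> S \<inter> D" "y \<in> D - S \<inter> D" "(x, y) \<in> E"
      using D connD by metis
    then show ?thesis using D(1) by blast
  qed
qed

lemma separation_swap: "sym E \<Longrightarrow> separation E V P Q \<Longrightarrow> separation E V Q P"
  unfolding separation_def sym_def by blast

lemma separation_edge:
  "separation E V P Q \<Longrightarrow> sym E \<Longrightarrow> E \<subseteq> V \<times> V \<Longrightarrow> (x, y) \<in> E \<Longrightarrow> x \<notin> P \<Longrightarrow> y \<in> Q"
  "separation E V P Q \<Longrightarrow> sym E \<Longrightarrow> E \<subseteq> V \<times> V \<Longrightarrow> (x, y) \<in> E \<Longrightarrow> x \<notin> Q \<Longrightarrow> y \<in> P"
  unfolding separation_def sym_def by blast+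

lemma conn_separation:
  assumes "separation E V P Q" "conn E B" "B \<subseteq> V" "B - Q \<noteq> {}" "B - P \<noteq> {}"
  shows "B \<inter> P \<inter> Q \<noteq> {}"
proof
  assume e: "B \<inter> P \<inter> Q = {}"
  have "P \<union> Q = V" using assms(1) by (simp add: separation_def)
  then have "B - Q \<subset> B" using assms e by blast
  then obtain x y where "x \<in> B - Q" "y \<in> B - (B - Q)" "(x, y) \<in> E"
    using connD[OF assms(2) _ assms(4)] by metis
  then show False using assms(1,3) e unfolding separation_def by blast
qed

text \<open>\<open>Q\<close> is attached to \<open>P\<close> only through
  \<open>P \<inter> Q\<close>, which lies in \<open>S\<close>, so all of \<open>Q\<close> can join
  that side at no cost in order. Only edges at vertices outside \<open>S\<close> have to survive in
  \<open>F\<close>; edges inside \<open>S\<close> may be added or removed freely.\<close>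

lemma separation_refine:
  assumes "separation E V P Q" "sym E" "E \<subseteq> V \<times> V" "separation F P R S" "P \<inter> Q \<subseteq> S"
    and "\<And>x y. (x, y) \<in> E \<Longrightarrow> x \<in> P - S \<Longrightarrow> y \<in> P \<Longrightarrow> (x, y) \<in> F"
  shows "separation E V R (S \<union> Q)" "R \<inter> (S \<union> Q) = R \<inter> S"
proof -
  have PV: "P \<union> Q = V" and RS: "R \<union> S = P" using assms(1,4) by (simp_all add: separation_def)
  show "R \<inter> (S \<union> Q) = R \<inter> S" using RS assms(5) by blast
  have "(x, y) \<notin> E" if "x \<in> R - (S \<union> Q)" "y \<in> S \<union> Q - R" for x y
  proof
    assume e: "(x, y) \<in> E"
    have "y \<in> P" using separation_edge(2)[OF assms(1-3) e] that by blast
    then have "y \<in> S - R" "x \<in> R - S" using that assms(5) by blast+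
    then show False using assms(4,6) e RS unfolding separation_def by blast
  qed
  then show "separation E V R (S \<union> Q)" using PV RS unfolding separation_def by blast
qed

section \<open>Contracting one edge and lifting back\<close>

lemma collapse_rel_sym: "sym E \<Longrightarrow> sym (collapse_rel u v E)"
  unfolding collapse_rel_def sym_def by force

lemma collapse_rel_subset:
  assumes "E \<subseteq> V \<times> V" "u \<in> V" "u \<noteq> v"
  shows "collapse_rel u v E \<subseteq> (V - {v}) \<times> (V - {v})"
  using assms unfolding collapse_rel_def collapse_def by (auto split: if_splits)

lemma collapse_relI: "(x, y) \<in> E \<Longrightarrow> (collapse u v x, collapse u v y) \<in> collapse_rel u v E"
  unfolding collapse_rel_def by force

lemma vimage_collapse: "collapse u v -` D = D - {v} \<union> (if u \<in> D then {v} else {})"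
  unfolding collapse_def by (auto split: if_splits)

lemma vimage_collapse_subset: "D \<subseteq> V - {v} \<Longrightarrow> v \<in> V \<Longrightarrow> collapse u v -` D \<subseteq> V"
  by (auto simp: vimage_collapse split: if_splits)

text \<open>Lifting a separator costs a vertex only if it contains \<open>u\<close>, and then just
  one, namely \<open>v\<close>. A separation that is too small by one after the contraction thus
  comes from one of critical order containing both ends of the edge.\<close>

lemma card_vimage_collapse:
  assumes "finite D"
  shows "card (collapse u v -` D) \<le> Suc (card D)"
    and "u \<notin> D \<Longrightarrow> card (collapse u v -` D) \<le> card D"
proof -
  have "collapse u v -` D \<subseteq> insert v D" by (auto simp: vimage_collapse)
  then have "card (collapse u v -` D) \<le> card (insert v D)" using assms by (intro card_mono) auto
  also have "\<dots> \<le> Suc (card D)" by (rule card_insert_le_m1) auto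
  finally show "card (collapse u v -` D) \<le> Suc (card D)" .
  show "card (collapse u v -` D) \<le> card D" if "u \<notin> D"
    using assms that by (intro card_mono) (auto simp: vimage_collapse)
qed

lemma conn_vimage_collapse:
  assumes "conn (collapse_rel u v E) D" "v \<notin> D" "(u, v) \<in> E" "sym E"
  shows "conn E (collapse u v -` D)"
  unfolding conn_def
proof (intro conjI allI impI)
  show "collapse u v -` D \<noteq> {}"
    using conn_nonempty[OF assms(1)] assms(2) by (auto simp: vimage_collapse)
  fix S assume S: "S \<subset> collapse u v -` D" "S \<noteq> {}"
  show "\<exists>x\<in>S. \<exists>y\<in>collapse u v -` D - S. (x, y) \<in> E"
  proof (cases "u \<in> D \<and> (u \<in> S \<longleftrightarrow> v \<notin> S)")
    case True
    then show ?thesis using assms(2-4) symD[OF assms(4)] by (auto simp: vimage_collapse)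
  next
    case False
    \<comment> \<open>\<open>S\<close> does not split \<open>u\<close> from \<open>v\<close>, so it
      is a union of fibres and its image is a genuine cut of \<open>D\<close>. In the other case the
      edge \<open>uv\<close> itself crosses.\<close>
    then have sat: "collapse u v x \<in> collapse u v ` S \<longleftrightarrow> x \<in> S" if "collapse u v x \<in> D" for x
      using that assms(2) unfolding collapse_def by (auto split: if_splits)
    have "collapse u v ` S \<subset> D"
    proof -
      obtain x where "x \<in> collapse u v -` D - S" using S by blast
      then show ?thesis using sat S by blast
    qed
    then obtain x y where xy: "x \<in> collapse u v ` S" "y \<in> D - collapse u v ` S"
        "(x, y) \<in> collapse_rel u v E"
      using connD[OF assms(1)] S by (metis image_is_empty)
    then obtain x' y' where e: "(x', y') \<in> E" "x = collapse u v x'" "y = collapse u v y'"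
      unfolding collapse_rel_def by auto
    have "x \<in> D" using xy(1) S(1) by blast
    then have "x' \<in> S" using xy(1) sat[of x'] e(2) by simp
    moreover have "y' \<in> collapse u v -` D - S" using xy(2) e(3) by blast
    ultimately show ?thesis using e(1) by blast
  qed
qed

lemma conn_image_collapse:
  assumes "conn E B"
  shows "conn (collapse_rel u v E) (collapse u v ` B)"
  unfolding conn_def
proof (intro conjI allI impI)
  show "collapse u v ` B \<noteq> {}" using conn_nonempty[OF assms] by simp
  fix S assume S: "S \<subset> collapse u v ` B" "S \<noteq> {}"
  let ?S = "B \<inter> collapse u v -` S"
  have "?S \<subset> B" "?S \<noteq> {}" using S by blast+
  then obtain x y where "x \<in> ?S" "y \<in> B - ?S" "(x, y) \<in> E" using connD[OF assms] by metis
  then show "\<exists>x\<in>S. \<exists>y\<in>collapse u v ` B - S. (x, y) \<in> collapse_rel u v E"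
    using collapse_relI[of x y E u v] by blast
qed

lemma separation_vimage_collapse:
  assumes "separation (collapse_rel u v E) (V - {v}) P Q" "u \<in> V" "v \<in> V" "u \<noteq> v"
  shows "separation E V (collapse u v -` P) (collapse u v -` Q)"
proof -
  have PQ: "P \<union> Q = V - {v}" using assms(1) by (simp add: separation_def)
  have "collapse u v -` P \<union> collapse u v -` Q = collapse u v -` (V - {v})" using PQ by blast
  also have "\<dots> = V" using assms by (auto simp: vimage_collapse)
  finally show ?thesis
    using assms(1) unfolding separation_def by (auto dest!: collapse_relI[of _ _ E u v])
qed

section \<open>Menger's theorem\<close>

text \<open>Disjoint connected sets take the place of disjoint paths.\<close>

definition linkage :: "('a \<times> 'a) set \<Rightarrow> 'a set \<Rightarrow> 'a set \<Rightarrow> 'a set \<Rightarrow> 'a set set \<Rightarrow> bool" where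
  "linkage E V A B \<D> \<longleftrightarrow> pairwise disjnt \<D> \<and>
     (\<forall>D\<in>\<D>. D \<subseteq> V \<and> conn E D \<and> D \<inter> A \<noteq> {} \<and> D \<inter> B \<noteq> {})"

lemma linkageD:
  assumes "linkage E V A B \<D>" "D \<in> \<D>"
  shows "D \<subseteq> V" "conn E D" "D \<inter> A \<noteq> {}" "D \<inter> B \<noteq> {}"
  using assms unfolding linkage_def by simp_all

lemma linkage_disjoint:
  assumes "linkage E V A B \<D>" "C \<in> \<D>" "D \<in> \<D>" "C \<noteq> D"
  shows "C \<inter> D = {}"
  using assms unfolding linkage_def by (simp add: pairwise_def disjnt_def)

lemma card_disjoint_image:
  assumes "\<And>D. D \<in> \<D> \<Longrightarrow> f D \<noteq> {}"
    and "\<And>C D. C \<in> \<D> \<Longrightarrow> D \<in> \<D> \<Longrightarrow> C \<noteq> D \<Longrightarrow> f C \<inter> f D = {}"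
  shows "card (f ` \<D>) = card \<D>" "pairwise disjnt (f ` \<D>)"
proof -
  have "inj_on f \<D>" using assms by (metis inf.idem inj_onI)
  then show "card (f ` \<D>) = card \<D>" by (rule card_image)
  show "pairwise disjnt (f ` \<D>)" using assms unfolding pairwise_def disjnt_def by blast
qed

text \<open>Choosing one vertex of \<open>X\<close> in each member is injective by disjointness,
  hence onto \<open>X\<close> by counting. So every vertex of \<open>X\<close> is taken and no
  member has room for a second one.\<close>

lemma disjoint_transversal:
  assumes "finite X" "pairwise disjnt \<D>" "card \<D> = card X" "\<And>D. D \<in> \<D> \<Longrightarrow> D \<inter> X \<noteq> {}"
    and "X \<noteq> {}"
  obtains d where "d ` X = \<D>" "\<And>x. x \<in> X \<Longrightarrow> d x \<inter> X = {x}"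
proof -
  have "\<forall>D\<in>\<D>. \<exists>x. x \<in> D \<inter> X" using assms(4) by blast
  then obtain g where g: "\<And>D. D \<in> \<D> \<Longrightarrow> g D \<in> D \<inter> X" by (metis bchoice)
  have dis: "C = D" if "C \<in> \<D>" "D \<in> \<D>" "x \<in> C" "x \<in> D" for x C D
    using assms(2) that unfolding pairwise_def disjnt_def by blast
  have inj: "inj_on g \<D>" using g dis by (metis IntD1 inj_onI)
  have fin: "finite \<D>" using assms by (metis card.infinite card_gt_0_iff less_irrefl)
  have "g ` \<D> = X"
    using assms(1,3) g by (intro card_subset_eq) (auto simp: card_image[OF inj])
  then have bij: "bij_betw g \<D> X" using inj by (simp add: bij_betw_def)
  show thesis
  proof
    show "inv_into \<D> g ` X = \<D>" using bij_betw_inv_into[OF bij] by (simp add: bij_betw_def)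
    fix x assume x: "x \<in> X"
    have *: "inv_into \<D> g x \<in> \<D>" "g (inv_into \<D> g x) = x" if "x \<in> X" for x
      using bij that by (auto simp: bij_betw_inv_into_right inv_into_into bij_betw_def)
    show "inv_into \<D> g x \<inter> X = {x}"
    proof (intro equalityI subsetI)
      fix y assume y: "y \<in> inv_into \<D> g x \<inter> X"
      then have "inv_into \<D> g y = inv_into \<D> g x" using * g dis x by (metis IntD1 IntD2)
      then show "y \<in> {x}" using * x y by (metis IntD2 singletonI)
    next
      fix y assume "y \<in> {x}"
      then show "y \<in> inv_into \<D> g x \<inter> X" using *[OF x] g x by (metis IntD1 IntI singletonD)
    qed
  qed
qed

text \<open>
  In the proof the contracted edge \<open>uv\<close> is removed on both sides of a separator \<open>X\<close> containing \<open>u\<close> and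
  \<open>v\<close>, so that the induction hypothesis also applies when one of the sides is the whole graph.
\<close>

lemma menger:
  assumes "finite V" "E \<subseteq> V \<times> V" "sym E" "A \<subseteq> V" "B \<subseteq> V"
    and "\<And>P Q. separation E V P Q \<Longrightarrow> A \<subseteq> P \<Longrightarrow> B \<subseteq> Q \<Longrightarrow> k \<le> card (P \<inter> Q)"
  shows "\<exists>\<D>. linkage E V A B \<D> \<and> card \<D> = k"
  using assms
proof (induction "card E" arbitrary: V E A B rule: less_induct)
  case less
  have finE: "finite E" using less.prems(1,2) finite_subset by blast
  show ?case
  proof (cases "E \<subseteq> Id")
    case True
    \<comment> \<open>Without proper edges every cover of \<open>V\<close> is a separation. This one
      has order \<open>card (A \<inter> B)\<close>, so singletons from \<open>A \<inter> B\<close>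
      form the linkage.\<close>
    have "separation E V A (B \<union> (V - A))"
      using True less.prems(4,5) unfolding separation_def by blast
    then have "k \<le> card (A \<inter> (B \<union> (V - A)))" using less.prems(6) by blast
    moreover have "A \<inter> (B \<union> (V - A)) = A \<inter> B" by blast
    ultimately obtain K where K: "K \<subseteq> A \<inter> B" "card K = k"
      by (metis obtain_subset_with_card_n)
    have "linkage E V A B ((\<lambda>x. {x}) ` K)"
      using K less.prems(4) unfolding linkage_def pairwise_def by auto
    moreover have "card ((\<lambda>x. {x}) ` K) = k" using K by (simp add: card_image)
    ultimately show ?thesis by blast
  next
    case False
    then obtain u v where uv: "(u, v) \<in> E" "u \<noteq> v" by (metis pair_in_Id_conv subrelI)
    then have V: "u \<in> V" "v \<in> V" and vu: "(v, u) \<in> E"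
      using less.prems(2,3) by (auto dest: symD)
    let ?c = "collapse u v" and ?E = "collapse_rel u v E" and ?V = "V - {v}"
    \<comment> \<open>Both orientations of the edge become the loop at \<open>u\<close>, so one of
      them can be left out without changing the image. This makes the number of edges drop
      strictly.\<close>
    have "map_prod ?c ?c (v, u) = map_prod ?c ?c (u, v)" "(u, v) \<in> E - {(v, u)}"
      using uv by (auto simp: collapse_def)
    then have "?E \<subseteq> map_prod ?c ?c ` (E - {(v, u)})"
      unfolding collapse_rel_def by (smt (verit) DiffI image_iff image_subsetI singletonD)
    then have "card ?E \<le> card (E - {(v, u)})"
      using finE by (meson card_image_le card_mono finite_Diff finite_imageI le_trans)
    also have "\<dots> < card E" using finE vu by (meson card_Diff1_less)
    finally have cE: "card ?E < card E" .
    show ?thesis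
    proof (cases "\<forall>P Q. separation ?E ?V P Q \<longrightarrow> ?c ` A \<subseteq> P \<longrightarrow> ?c ` B \<subseteq> Q \<longrightarrow> k \<le> card (P \<inter> Q)")
      case True
      have "?c ` A \<subseteq> ?V" "?c ` B \<subseteq> ?V"
        using less.prems(4,5) V uv by (auto simp: collapse_def)
      then have "\<exists>\<D>. linkage ?E ?V (?c ` A) (?c ` B) \<D> \<and> card \<D> = k"
        using True less.prems(1)
        by (intro less.hyps[OF cE _ collapse_rel_subset[OF less.prems(2) V(1) uv(2)]
              collapse_rel_sym[OF less.prems(3)]]) simp_all
      then obtain \<D> where \<D>: "linkage ?E ?V (?c ` A) (?c ` B) \<D>" "card \<D> = k" by blast
      have D: "v \<notin> D" "D \<subseteq> ?V" "conn ?E D" "D \<inter> ?c ` A \<noteq> {}" "D \<inter> ?c ` B \<noteq> {}" if "D \<in> \<D>" for D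
        using \<D>(1) that unfolding linkage_def by blast+
      let ?f = "\<lambda>D. ?c -` D"
      have co: "conn E (?f D)" if "D \<in> \<D>" for D
        using conn_vimage_collapse[OF D(3,1)[OF that] uv(1) less.prems(3)] .
      have dis: "?f C \<inter> ?f D = {}" if "C \<in> \<D>" "D \<in> \<D>" "C \<noteq> D" for C D
        using \<D>(1) that unfolding linkage_def pairwise_def disjnt_def by blast
      have "card (?f ` \<D>) = k" "pairwise disjnt (?f ` \<D>)"
        using card_disjoint_image[of \<D> ?f] dis \<D>(2) conn_nonempty[OF co] by auto
      moreover have "?f D \<subseteq> V" "?f D \<inter> A \<noteq> {}" "?f D \<inter> B \<noteq> {}" if "D \<in> \<D>" for D
        using D[OF that] vimage_collapse_subset[of D V v u] V by blast+
      ultimately have "linkage E V A B (?f ` \<D>)" using co unfolding linkage_def by simp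
      then show ?thesis using \<open>card (?f ` \<D>) = k\<close> by blast
    next
      case False
      then obtain P' Q' where s': "separation ?E ?V P' Q'" "?c ` A \<subseteq> P'" "?c ` B \<subseteq> Q'"
          "card (P' \<inter> Q') < k" by (meson not_le)
      define P Q where PQ: "P = ?c -` P'" "Q = ?c -` Q'"
      define X where "X = P \<inter> Q"
      have s: "separation E V P Q" using separation_vimage_collapse[OF s'(1) V uv(2)] PQ by simp
      have sub: "A \<subseteq> P" "B \<subseteq> Q" using s' PQ by auto
      have PV: "P \<subseteq> V" "Q \<subseteq> V" "X \<subseteq> P" "X \<subseteq> Q" "P \<union> Q = V"
        using s unfolding separation_def X_def by blast+
      have fins: "finite (P' \<inter> Q')" "finite X" "finite P" "finite Q"
        using s'(1) PV less.prems(1) unfolding separation_def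
        by (metis finite_Diff finite_Int finite_Un finite_subset)+
      have XX: "X = ?c -` (P' \<inter> Q')" by (simp add: PQ X_def)
      \<comment> \<open>The lifted order is at least \<open>k\<close> and at most one more than an
        order below \<open>k\<close>. So it equals \<open>k\<close>, and the extra vertex is due to
        \<open>u\<close> being in the separator.\<close>
      have "k \<le> card X" using less.prems(6)[OF s sub] X_def by simp
      moreover have "card X \<le> Suc (card (P' \<inter> Q'))"
          "u \<notin> P' \<inter> Q' \<Longrightarrow> card X \<le> card (P' \<inter> Q')"
        using card_vimage_collapse[OF fins(1), of u v] by (simp_all add: XX)
      ultimately have "u \<in> P' \<inter> Q'" "card X = k" using s'(4) by linarith+
      then have X: "u \<in> X" "v \<in> X" "card X = k"
        using XX uv by (auto simp: vimage_collapse)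
      let ?R = "{(u, v), (v, u)}"
      have card_less: "card (E \<inter> W \<times> W - ?R) < card E" for W
        using finE uv by (intro psubset_card_mono) auto
      have sy: "sym (E \<inter> W \<times> W - ?R)" for W
        using less.prems(3) unfolding sym_def by blast
      have "\<exists>\<D>. linkage (E \<inter> P \<times> P - ?R) P A X \<D> \<and> card \<D> = k"
      proof (rule less.hyps[OF card_less fins(3) _ sy sub(1) PV(3)])
        fix R S assume R: "separation (E \<inter> P \<times> P - ?R) P R S" "A \<subseteq> R" "X \<subseteq> S"
        have F: "separation E V R (S \<union> Q)" "R \<inter> (S \<union> Q) = R \<inter> S"
          using separation_refine[OF s less.prems(3,2) R(1)] R(3) X unfolding X_def by blast+
        show "k \<le> card (R \<inter> S)"
          using less.prems(6)[OF F(1) R(2)] F(2) sub by auto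
      qed auto
      then obtain \<D>1 where \<D>1: "linkage (E \<inter> P \<times> P - ?R) P A X \<D>1" "card \<D>1 = k" by blast
      have "\<exists>\<D>. linkage (E \<inter> Q \<times> Q - ?R) Q X B \<D> \<and> card \<D> = k"
      proof (rule less.hyps[OF card_less fins(4) _ sy PV(4) sub(2)])
        fix R S assume R: "separation (E \<inter> Q \<times> Q - ?R) Q R S" "X \<subseteq> R" "B \<subseteq> S"
        have F: "separation E V S (R \<union> P)" "S \<inter> (R \<union> P) = S \<inter> R"
          using separation_refine[OF separation_swap[OF less.prems(3) s] less.prems(3,2)
              separation_swap[OF sy R(1)]] R(2) X unfolding X_def by blast+
        show "k \<le> card (R \<inter> S)"
          using less.prems(6)[OF separation_swap[OF less.prems(3) F(1)]] R(3) F(2) sub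
          by (auto simp: Int_commute)
      qed auto
      then obtain \<D>2 where \<D>2: "linkage (E \<inter> Q \<times> Q - ?R) Q X B \<D>2" "card \<D>2 = k" by blast
      have Xne: "X \<noteq> {}" using X by blast
      obtain d1 where d1: "d1 ` X = \<D>1" "\<And>x. x \<in> X \<Longrightarrow> d1 x \<inter> X = {x}"
        using disjoint_transversal[of X \<D>1] \<D>1 X fins(2) Xne unfolding linkage_def by metis
      obtain d2 where d2: "d2 ` X = \<D>2" "\<And>x. x \<in> X \<Longrightarrow> d2 x \<inter> X = {x}"
        using disjoint_transversal[of X \<D>2] \<D>2 X fins(2) Xne unfolding linkage_def by metis
      have d1m: "d1 x \<in> \<D>1" and d2m: "d2 x \<in> \<D>2" if "x \<in> X" for x
        using that d1(1) d2(1) by blast+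
      note 1 = linkageD[OF \<D>1(1) d1m] and 2 = linkageD[OF \<D>2(1) d2m]
      have co: "conn E (d1 x)" "conn E (d2 x)" if "x \<in> X" for x
        using conn_mono[OF 1(2)[OF that]] conn_mono[OF 2(2)[OF that]] by blast+
      have ne12: "d1 x \<noteq> d1 y" "d2 x \<noteq> d2 y" if "x \<in> X" "y \<in> X" "x \<noteq> y" for x y
        using d1(2) d2(2) that by (metis singleton_inject)+
      have dis1: "d1 x \<inter> d1 y = {}" if "x \<in> X" "y \<in> X" "x \<noteq> y" for x y
        using linkage_disjoint[OF \<D>1(1) d1m d1m ne12(1)] that by blast
      have dis2: "d2 x \<inter> d2 y = {}" if "x \<in> X" "y \<in> X" "x \<noteq> y" for x y
        using linkage_disjoint[OF \<D>2(1) d2m d2m ne12(2)] that by blast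
      \<comment> \<open>Members on different sides can meet only in \<open>X\<close>, where each has
        exactly one vertex; hence only equally labelled members meet, and they can be glued
        there.\<close>
      have dis12: "d1 x \<inter> d2 y = {}" if "x \<in> X" "y \<in> X" "x \<noteq> y" for x y
      proof (rule equals0I)
        fix z assume z: "z \<in> d1 x \<inter> d2 y"
        then have "z \<in> X" using 1(1)[OF that(1)] 2(1)[OF that(2)] unfolding X_def by blast
        then have "z = x" "z = y" using z d1(2)[OF that(1)] d2(2)[OF that(2)] by auto
        then show False using that(3) by simp
      qed
      let ?f = "\<lambda>x. d1 x \<union> d2 x"
      have dis: "?f x \<inter> ?f y = {}" if "x \<in> X" "y \<in> X" "x \<noteq> y" for x y
        using dis1[OF that] dis2[OF that] dis12[OF that] dis12[OF that(2,1) not_sym[OF that(3)]]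
        by (simp add: Int_Un_distrib Int_Un_distrib2 Int_commute)
      have mem: "x \<in> d1 x" "x \<in> d2 x" if "x \<in> X" for x
        using d1(2)[OF that] d2(2)[OF that] by auto
      have "inj_on ?f X"
      proof (rule inj_onI)
        fix x y assume xy: "x \<in> X" "y \<in> X" "?f x = ?f y"
        have "?f x \<inter> ?f y \<noteq> {}" unfolding xy(3) using mem(1)[OF xy(2)] by auto
        then show "x = y" using dis[OF xy(1,2)] by argo
      qed
      then have "card (?f ` X) = k" using X(3) by (simp add: card_image)
      moreover have "pairwise disjnt (?f ` X)" using dis
        by (auto intro!: pairwise_imageI simp: disjnt_def)
      moreover have "conn E (?f x)" if "x \<in> X" for x
        using conn_join[OF less.prems(3) co[OF that] mem[OF that]] by simp
      moreover have "?f x \<subseteq> V" "?f x \<inter> A \<noteq> {}" "?f x \<inter> B \<noteq> {}" if "x \<in> X" for x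
        using 1(1,3)[OF that] 2(1,4)[OF that] PV by auto
      ultimately have "linkage E V A B (?f ` X) \<and> card (?f ` X) = k" unfolding linkage_def by simp
      then show ?thesis by (rule exI)
    qed
  qed
qed

section \<open>Clique models\<close>

definition clique_model :: "('a \<times> 'a) set \<Rightarrow> 'a set \<Rightarrow> 'a set set \<Rightarrow> bool" where
  "clique_model E V \<B> \<longleftrightarrow> pairwise disjnt \<B> \<and> (\<forall>B\<in>\<B>. B \<subseteq> V \<and> conn E B) \<and>
     (\<forall>B\<in>\<B>. \<forall>C\<in>\<B>. B \<noteq> C \<longrightarrow> (\<exists>x\<in>B. \<exists>y\<in>C. (x, y) \<in> E))"

definition rooted :: "'a set \<Rightarrow> 'a set set \<Rightarrow> bool" where
  "rooted Z \<B> \<longleftrightarrow> Z \<subseteq> \<Union>\<B> \<and> (\<forall>B\<in>\<B>. \<forall>x\<in>B \<inter> Z. \<forall>y\<in>B \<inter> Z. x = y)"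

definition tied :: "('a \<times> 'a) set \<Rightarrow> 'a set \<Rightarrow> 'a set \<Rightarrow> 'a set set \<Rightarrow> bool" where
  "tied E V Z \<B> \<longleftrightarrow> (\<forall>P Q B. separation E V P Q \<longrightarrow> Z \<subseteq> P \<longrightarrow> B \<in> \<B> \<longrightarrow> B \<subseteq> Q - P \<longrightarrow>
     card Z \<le> card (P \<inter> Q))"

lemma clique_modelD:
  assumes "clique_model E V \<B>" "B \<in> \<B>"
  shows "B \<subseteq> V" "conn E B" "B \<noteq> {}"
  using assms conn_nonempty unfolding clique_model_def by auto

lemma clique_model_disjoint:
  assumes "clique_model E V \<B>" "B \<in> \<B>" "C \<in> \<B>" "x \<in> B" "x \<in> C"
  shows "B = C"
  using assms unfolding clique_model_def pairwise_def disjnt_def by blast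

lemma clique_model_adjacent:
  assumes "clique_model E V \<B>" "B \<in> \<B>" "C \<in> \<B>" "B \<noteq> C"
  obtains x y where "x \<in> B" "y \<in> C" "(x, y) \<in> E"
  using assms unfolding clique_model_def by blast

lemma tiedD:
  assumes "tied E V Z \<B>" "separation E V P Q" "Z \<subseteq> P" "B \<in> \<B>" "B \<subseteq> Q - P"
  shows "card Z \<le> card (P \<inter> Q)"
  using assms unfolding tied_def by blast

text \<open>Restricting, extending, contracting and lifting a model all act on each branch set
  separately. The number of branch sets persists because the images are nonempty and
  disjoint.\<close>

lemma clique_model_image:
  assumes "\<And>B. B \<in> \<B> \<Longrightarrow> f B \<subseteq> V" "\<And>B. B \<in> \<B> \<Longrightarrow> conn E (f B)"
    and dis: "\<And>B C. B \<in> \<B> \<Longrightarrow> C \<in> \<B> \<Longrightarrow> B \<noteq> C \<Longrightarrow> f B \<inter> f C = {}"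
    and adj: "\<And>B C. B \<in> \<B> \<Longrightarrow> C \<in> \<B> \<Longrightarrow> B \<noteq> C \<Longrightarrow> \<exists>x\<in>f B. \<exists>y\<in>f C. (x, y) \<in> E"
  shows "clique_model E V (f ` \<B>)" "card (f ` \<B>) = card \<B>"
proof -
  have "pairwise disjnt (f ` \<B>) \<and> card (f ` \<B>) = card \<B>"
    using card_disjoint_image[of \<B> f] dis conn_nonempty[OF assms(2)] by auto
  moreover have "\<exists>x\<in>f B. \<exists>y\<in>f C. (x, y) \<in> E" if "B \<in> \<B>" "C \<in> \<B>" "f B \<noteq> f C" for B C
    using adj that by metis
  ultimately show "clique_model E V (f ` \<B>)" "card (f ` \<B>) = card \<B>"
    using assms(1,2) unfolding clique_model_def by auto
qed

lemma card_disjoint_le: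
  assumes "finite Z" "pairwise disjnt \<B>" "\<And>B. B \<in> \<B> \<Longrightarrow> B \<inter> Z \<noteq> {}"
  shows "card \<B> \<le> card Z"
proof -
  have "\<forall>B\<in>\<B>. \<exists>x. x \<in> B \<inter> Z" using assms(3) by blast
  then obtain g where g: "\<And>B. B \<in> \<B> \<Longrightarrow> g B \<in> B \<inter> Z" by (metis bchoice)
  have "inj_on g \<B>"
  proof (rule inj_onI)
    fix B C assume BC: "B \<in> \<B>" "C \<in> \<B>" "g B = g C"
    then have "g B \<in> B \<inter> C" using g[of B] g[of C] by simp
    then show "B = C" using pairwiseD[OF assms(2) BC(1,2)] by (auto simp: disjnt_iff)
  qed
  then show ?thesis using g assms(1) by (intro card_inj_on_le[of g]) auto
qed

text \<open>Every branch set is adjacent or equal to \<open>B0\<close>, so it reaches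
  \<open>Q\<close>; if it also meets \<open>P\<close>, connectedness makes it meet
  \<open>P \<inter> Q\<close>. The clique put on \<open>P \<inter> Q\<close> therefore replaces all
  connections and adjacencies that ran through \<open>P\<close>. Tiedness is inherited since a
  separation \<open>(R, S)\<close> of \<open>Q\<close> with
  \<open>P \<inter> Q \<subseteq> R\<close> extends to \<open>(R \<union> P, S)\<close> with the
  same order.\<close>

lemma clique_model_restrict:
  assumes E: "E \<subseteq> V \<times> V" "sym E" and M: "clique_model E V \<B>" and t: "tied E V Z \<B>"
    and sep: "separation E V P Q" and Z: "Z \<subseteq> P" "card (P \<inter> Q) = card Z"
    and B0: "B0 \<in> \<B>" "B0 \<subseteq> Q - P"
    and F: "F = E \<inter> Q \<times> Q \<union> (P \<inter> Q) \<times> (P \<inter> Q)"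
  shows "clique_model F Q ((\<lambda>B. B \<inter> Q) ` \<B>)" "card ((\<lambda>B. B \<inter> Q) ` \<B>) = card \<B>"
    and "tied F Q (P \<inter> Q) ((\<lambda>B. B \<inter> Q) ` \<B>)"
proof -
  note edge = separation_edge[OF sep E(2,1)]
  have PQ: "P \<union> Q = V" using sep by (simp add: separation_def)
  have meets: "B \<inter> Q \<noteq> {}" if B: "B \<in> \<B>" for B
  proof (cases "B = B0")
    case True
    then show ?thesis using B0 clique_modelD(3)[OF M B] by blast
  next
    case False
    then obtain x y where "x \<in> B" "y \<in> B0" "(x, y) \<in> E"
      using clique_model_adjacent[OF M B B0(1)] by blast
    then show ?thesis using edge(2) B0(2) by blast
  qed
  have hit: "B \<inter> (P \<inter> Q) \<noteq> {}" if B: "B \<in> \<B>" and BP: "B \<inter> P \<noteq> {}" for B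
  proof (cases "B - Q = {} \<or> B - P = {}")
    case True
    then show ?thesis using BP meets[OF B] by blast
  next
    case False
    then show ?thesis
      using conn_separation[OF sep clique_modelD(2,1)[OF M B]] by (simp add: Int_assoc)
  qed
  have "conn F (B \<inter> Q)" if B: "B \<in> \<B>" for B
    unfolding conn_def
  proof (intro conjI allI impI)
    show "B \<inter> Q \<noteq> {}" by (rule meets[OF B])
    fix S assume S: "S \<subset> B \<inter> Q" "S \<noteq> {}"
    note cB = clique_modelD(2)[OF M B]
    \<comment> \<open>If both sides of the cut meet \<open>P\<close>, a clique edge crosses. If one
      side avoids \<open>P\<close>, all edges at it stay in \<open>Q\<close>, so an edge of the
      connected set \<open>B\<close> crosses; when that side is the complement, \<open>B - Q\<close>
      is first added to \<open>S\<close>.\<close>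
    consider "S \<inter> P \<noteq> {}" "(B \<inter> Q - S) \<inter> P \<noteq> {}" | "S \<inter> P = {}" | "(B \<inter> Q - S) \<inter> P = {}"
      by blast
    then show "\<exists>x\<in>S. \<exists>y\<in>B \<inter> Q - S. (x, y) \<in> F"
    proof cases
      case 1
      then show ?thesis using S unfolding F by blast
    next
      case 2
      have "S \<subset> B" using S by blast
      then obtain x y where xy: "x \<in> S" "y \<in> B - S" "(x, y) \<in> E"
        using connD[OF cB _ S(2)] by metis
      then have "y \<in> Q" using edge(1) 2 by blast
      then show ?thesis using xy S unfolding F by blast
    next
      case 3
      have "S \<union> (B - Q) \<subset> B" "S \<union> (B - Q) \<noteq> {}" using S by blast+
      then obtain x y where xy: "x \<in> S \<union> (B - Q)" "y \<in> B - (S \<union> (B - Q))" "(x, y) \<in> E"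
        using connD[OF cB] by metis
      then have "x \<in> Q" using edge(2)[OF xy(3)] 3 by blast
      then show ?thesis using xy S unfolding F by blast
    qed
  qed
  moreover have "\<exists>x\<in>B \<inter> Q. \<exists>y\<in>C \<inter> Q. (x, y) \<in> F" if BC: "B \<in> \<B>" "C \<in> \<B>" "B \<noteq> C" for B C
  proof -
    obtain x y where xy: "x \<in> B" "y \<in> C" "(x, y) \<in> E"
      using clique_model_adjacent[OF M BC] by blast
    show ?thesis
    proof (cases "x \<in> Q \<and> y \<in> Q")
      case True
      then show ?thesis using xy unfolding F by blast
    next
      case False
      have "x \<in> V" "y \<in> V" using xy(3) E(1) by auto
      then have "x \<in> P" "y \<in> P"
        using False edge(2)[OF xy(3)] edge(2)[OF symD[OF E(2) xy(3)]] PQ by blast+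
      then obtain s t where "s \<in> B \<inter> (P \<inter> Q)" "t \<in> C \<inter> (P \<inter> Q)"
        using hit[OF BC(1)] hit[OF BC(2)] xy by blast
      then show ?thesis unfolding F by blast
    qed
  qed
  moreover have "(B \<inter> Q) \<inter> (C \<inter> Q) = {}" if "B \<in> \<B>" "C \<in> \<B>" "B \<noteq> C" for B C
    using clique_model_disjoint[OF M that(1,2)] that(3) by blast
  ultimately show "clique_model F Q ((\<lambda>B. B \<inter> Q) ` \<B>)" "card ((\<lambda>B. B \<inter> Q) ` \<B>) = card \<B>"
    using clique_model_image[of \<B> "\<lambda>B. B \<inter> Q" Q F] by simp_all
  have "card (P \<inter> Q) \<le> card (R \<inter> S)"
    if R: "separation F Q R S" "P \<inter> Q \<subseteq> R" and B: "B \<in> \<B>" "B \<inter> Q \<subseteq> S - R" for R S B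
  proof -
    have symF: "sym F" using E(2) unfolding F sym_def by blast
    have RS: "R \<union> S = Q" using R(1) by (simp add: separation_def)
    have s: "separation E V S (R \<union> P)" "S \<inter> (R \<union> P) = S \<inter> R"
      using separation_refine[OF separation_swap[OF E(2) sep] E(2,1) separation_swap[OF symF R(1)]] R(2)
      unfolding F by blast+
    have "B \<inter> P = {}" using hit[OF B(1)] B(2) R(2) by blast
    moreover have "B \<subseteq> V" using clique_modelD(1)[OF M B(1)] .
    ultimately have "B \<subseteq> S - (R \<union> P)" using B(2) PQ by blast
    then have "card Z \<le> card ((R \<union> P) \<inter> S)"
      using tiedD[OF t separation_swap[OF E(2) s(1)] _ B(1)] Z(1) by blast
    then show ?thesis using s(2) Z(2) by (simp add: Int_commute)
  qed
  then show "tied F Q (P \<inter> Q) ((\<lambda>B. B \<inter> Q) ` \<B>)" unfolding tied_def by blast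
qed

text \<open>Each branch set absorbs the linkage member through its vertex of
  \<open>P \<inter> Q\<close>, if it has one, and so acquires the root at the other end. An
  adjacency that relied on a fictitious edge of \<open>P \<inter> Q\<close> is between two branch
  sets that both acquire roots, and distinct roots are adjacent in \<open>E\<close>.\<close>

lemma rooted_model_extend:
  assumes E: "E \<subseteq> V \<times> V" "sym E" and PQ: "P \<subseteq> V" "Q \<subseteq> V" "finite P"
    and Z: "Z \<subseteq> P" "card (P \<inter> Q) = card Z" "Z \<noteq> {}" "\<And>x y. x \<in> Z \<Longrightarrow> y \<in> Z \<Longrightarrow> x \<noteq> y \<Longrightarrow> (x, y) \<in> E"
    and M: "clique_model (E \<inter> Q \<times> Q \<union> (P \<inter> Q) \<times> (P \<inter> Q)) Q \<C>" and r: "rooted (P \<inter> Q) \<C>"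
    and L: "linkage E P Z (P \<inter> Q) \<L>" "card \<L> = card Z"
  shows "\<exists>\<D>. clique_model E V \<D> \<and> card \<D> = card \<C> \<and> rooted Z \<D>"
proof -
  let ?S = "P \<inter> Q"
  define f where "f B = B \<union> \<Union>{D \<in> \<L>. D \<inter> B \<noteq> {}}" for B
  have fin: "finite Z" "finite ?S" using PQ(3) Z(1) finite_subset by auto
  have Sne: "?S \<noteq> {}" using Z(2,3) fin by (metis card_0_eq card.empty)
  have dL: "pairwise disjnt \<L>" using L(1) by (simp add: linkage_def)
  obtain d where d: "d ` ?S = \<L>" "\<And>s. s \<in> ?S \<Longrightarrow> d s \<inter> ?S = {s}"
    using disjoint_transversal[OF fin(2) dL _ linkageD(4)[OF L(1)] Sne] L(2) Z(2) by metis
  obtain e where e: "e ` Z = \<L>" "\<And>z. z \<in> Z \<Longrightarrow> e z \<inter> Z = {z}"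
    using disjoint_transversal[OF fin(1) dL L(2) linkageD(3)[OF L(1)] Z(3)] by metis
  have oneS: "x = y" if D: "D \<in> \<L>" and x: "x \<in> D" "x \<in> ?S" and y: "y \<in> D" "y \<in> ?S" for D x y
  proof -
    obtain s where "s \<in> ?S" "D = d s" using D d(1) by blast
    then have "D \<inter> ?S = {s}" using d(2) by simp
    then show ?thesis using x y by (metis IntI singletonD)
  qed
  have oneZ: "x = y" if D: "D \<in> \<L>" and x: "x \<in> D" "x \<in> Z" and y: "y \<in> D" "y \<in> Z" for D x y
  proof -
    obtain s where "s \<in> Z" "D = e s" using D e(1) by blast
    then have "D \<inter> Z = {s}" using e(2) by simp
    then show ?thesis using x y by (metis IntI singletonD)
  qed
  have oneB: "x = y" if "B \<in> \<C>" "x \<in> B" "x \<in> ?S" "y \<in> B" "y \<in> ?S" for B x y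
    using r that unfolding rooted_def by blast
  have inS: "x \<in> ?S" if "D \<in> \<L>" "B \<in> \<C>" "x \<in> D" "x \<in> B" for D B x
    using linkageD(1)[OF L(1)] clique_modelD(1)[OF M] that by blast
  \<comment> \<open>A fictitious edge inside \<open>B\<close> has both ends in
    \<open>P \<inter> Q\<close>, and rootedness makes them equal; only loops are lost.\<close>
  have conB: "conn E B" if B: "B \<in> \<C>" for B
    using clique_modelD(2)[OF M B] by (rule conn_mono) (use oneB[OF B] in auto)
  have fV: "f B \<subseteq> V" if B: "B \<in> \<C>" for B
    using clique_modelD(1)[OF M B] linkageD(1)[OF L(1)] PQ unfolding f_def by blast
  have fcon: "conn E (f B)" if B: "B \<in> \<C>" for B
    unfolding f_def using linkageD(2)[OF L(1)] by (intro conn_absorb[OF conB[OF B] _ E(2)]) auto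
  have fdis: "f B \<inter> f C = {}" if BC: "B \<in> \<C>" "C \<in> \<C>" "B \<noteq> C" for B C
  proof (rule equals0I)
    have dis: "x \<notin> C" if "x \<in> B" for x using clique_model_disjoint[OF M BC(1,2)] BC(3) that by blast
    have dis': False if D: "D \<in> \<L>" "D \<inter> B \<noteq> {}" "D \<inter> C \<noteq> {}" for D
    proof -
      obtain x y where "x \<in> D" "x \<in> B" "y \<in> D" "y \<in> C" using D by blast
      then show False using oneS[OF D(1)] inS[OF D(1)] BC dis by metis
    qed
    fix x assume "x \<in> f B \<inter> f C"
    then consider "x \<in> B" "x \<in> C" | D where "D \<in> \<L>" "x \<in> B" "x \<in> D" "D \<inter> C \<noteq> {}"
      | D where "D \<in> \<L>" "x \<in> C" "x \<in> D" "D \<inter> B \<noteq> {}"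
      | D D' where "D \<in> \<L>" "D' \<in> \<L>" "x \<in> D" "x \<in> D'" "D \<inter> B \<noteq> {}" "D' \<inter> C \<noteq> {}"
      unfolding f_def by blast
    then show False
    proof cases
      case 4
      then have "D = D'" using linkage_disjoint[OF L(1)] by blast
      then show ?thesis using 4 dis' by blast
    qed (use dis dis' in blast)+
  qed
  have root: "\<exists>z\<in>f B. z \<in> Z \<and> z \<in> d s" if "B \<in> \<C>" "s \<in> B" "s \<in> ?S" for B s
  proof -
    have D: "d s \<in> \<L>" "s \<in> d s" using d that(3) by blast+
    then obtain z where "z \<in> d s" "z \<in> Z" using linkageD(3)[OF L(1)] by blast
    then show ?thesis using D that(2) unfolding f_def by blast
  qed
  have fadj: "\<exists>x\<in>f B. \<exists>y\<in>f C. (x, y) \<in> E" if BC: "B \<in> \<C>" "C \<in> \<C>" "B \<noteq> C" for B C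
  proof -
    obtain x y where xy: "x \<in> B" "y \<in> C" "(x, y) \<in> E \<inter> Q \<times> Q \<union> ?S \<times> ?S"
      using clique_model_adjacent[OF M BC] by blast
    show ?thesis
    proof (cases "(x, y) \<in> E")
      case True
      then show ?thesis using xy unfolding f_def by blast
    next
      case False
      then obtain z z' where "z \<in> f B" "z \<in> Z" "z' \<in> f C" "z' \<in> Z"
        using xy root[OF BC(1)] root[OF BC(2)] by blast
      moreover from this have "z \<noteq> z'" using fdis[OF BC] by blast
      ultimately show ?thesis using Z(4) by blast
    qed
  qed
  have "rooted Z (f ` \<C>)"
    unfolding rooted_def
  proof (intro conjI ballI subsetI)
    fix z assume z: "z \<in> Z"
    then have D: "e z \<in> \<L>" "z \<in> e z" using e by blast+
    then obtain s where s: "s \<in> e z" "s \<in> ?S" using linkageD(4)[OF L(1)] by blast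
    then obtain B where "B \<in> \<C>" "s \<in> B" using r unfolding rooted_def by blast
    then show "z \<in> \<Union>(f ` \<C>)" using D s unfolding f_def by blast
  next
    fix B' z y assume "B' \<in> f ` \<C>" and zy: "z \<in> B' \<inter> Z" "y \<in> B' \<inter> Z"
    then obtain B where B: "B \<in> \<C>" "B' = f B" by blast
    \<comment> \<open>A root already inside \<open>B\<close> lies in \<open>P \<inter> Q\<close>, so
      the member through it meets \<open>B\<close> as well. Two roots in \<open>f B\<close> thus
      lead to members that share the only vertex of \<open>B\<close> in \<open>P \<inter> Q\<close>,
      hence to one member, which has a single root.\<close>
    have path: "\<exists>D\<in>\<L>. w \<in> D \<and> (\<exists>s\<in>D. s \<in> ?S \<and> s \<in> B)" if w: "w \<in> f B" "w \<in> Z" for w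
    proof (cases "w \<in> B")
      case True
      then have "w \<in> ?S" using w Z(1) clique_modelD(1)[OF M B(1)] by blast
      moreover have "e w \<in> \<L>" "w \<in> e w" using e w by blast+
      ultimately show ?thesis using True by blast
    next
      case False
      then obtain D where "D \<in> \<L>" "w \<in> D" "D \<inter> B \<noteq> {}" using w unfolding f_def by blast
      then show ?thesis using inS[OF _ B(1)] by blast
    qed
    obtain D s where 1: "D \<in> \<L>" "z \<in> D" "s \<in> D" "s \<in> ?S" "s \<in> B" using path zy B(2) by blast
    obtain D' t where 2: "D' \<in> \<L>" "y \<in> D'" "t \<in> D'" "t \<in> ?S" "t \<in> B" using path zy B(2) by blast
    have "s = t" by (rule oneB[OF B(1) 1(5,4) 2(5,4)])
    then have "D = D'" using linkage_disjoint[OF L(1) 1(1) 2(1)] 1(3) 2(3) by blast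
    then show "z = y" using oneZ[OF 1(1,2) _ _ _] 2(2) zy by blast
  qed
  moreover note clique_model_image[of \<C> f V E, OF fV fcon fdis fadj]
  ultimately show ?thesis by blast
qed

text \<open>The hypothesis \<open>no\<close> excludes only that \<open>u\<close> and
  \<open>v\<close> lie in different branch sets, whose images would both contain \<open>u\<close>.
  Either end may lie outside all branch sets.\<close>

lemma clique_model_collapse:
  assumes M: "clique_model E V \<B>" and uv: "u \<in> V" "v \<in> V" "u \<noteq> v"
    and no: "\<And>B C. B \<in> \<B> \<Longrightarrow> C \<in> \<B> \<Longrightarrow> u \<in> B \<Longrightarrow> v \<in> C \<Longrightarrow> B = C"
  shows "clique_model (collapse_rel u v E) (V - {v}) ((`) (collapse u v) ` \<B>)"
    and "card ((`) (collapse u v) ` \<B>) = card \<B>"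
proof -
  let ?c = "collapse u v"
  have 1: "?c ` B \<subseteq> V - {v}" if "B \<in> \<B>" for B
    using clique_modelD(1)[OF M that] uv by (auto simp: collapse_def)
  have 2: "conn (collapse_rel u v E) (?c ` B)" if "B \<in> \<B>" for B
    using conn_image_collapse[OF clique_modelD(2)[OF M that]] .
  have 3: "?c ` B \<inter> ?c ` C = {}" if BC: "B \<in> \<B>" "C \<in> \<B>" "B \<noteq> C" for B C
  proof (rule equals0I)
    fix z assume "z \<in> ?c ` B \<inter> ?c ` C"
    then obtain x y where "x \<in> B" "y \<in> C" "?c x = ?c y" by auto
    then show False
      using clique_model_disjoint[OF M BC(1,2)] no[OF BC(1,2)] no[OF BC(2,1)] BC(3)
      by (auto simp: collapse_def split: if_splits)
  qed
  have 4: "\<exists>x\<in>?c ` B. \<exists>y\<in>?c ` C. (x, y) \<in> collapse_rel u v E"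
    if BC: "B \<in> \<B>" "C \<in> \<B>" "B \<noteq> C" for B C
  proof -
    obtain x y where "x \<in> B" "y \<in> C" "(x, y) \<in> E" using clique_model_adjacent[OF M BC] by blast
    then show ?thesis using collapse_relI[of x y E u v] by blast
  qed
  show "clique_model (collapse_rel u v E) (V - {v}) ((`) ?c ` \<B>)" "card ((`) ?c ` \<B>) = card \<B>"
    using clique_model_image[of \<B> "(`) ?c", OF 1 2 3 4] by simp_all
qed

lemma clique_model_vimage_collapse:
  assumes M: "clique_model (collapse_rel u v E) (V - {v}) \<D>"
    and E: "sym E" "(u, v) \<in> E" "v \<in> V" and r: "rooted Z \<D>" "v \<notin> Z"
  shows "clique_model E V ((-`) (collapse u v) ` \<D>)"
    and "card ((-`) (collapse u v) ` \<D>) = card \<D>"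
    and "rooted Z ((-`) (collapse u v) ` \<D>)"
proof -
  let ?c = "collapse u v"
  have 1: "?c -` D \<subseteq> V" if "D \<in> \<D>" for D
    using vimage_collapse_subset[OF clique_modelD(1)[OF M that] E(3)] .
  have 2: "conn E (?c -` D)" if "D \<in> \<D>" for D
    using conn_vimage_collapse[OF clique_modelD(2)[OF M that] _ E(2,1)] clique_modelD(1)[OF M that]
    by blast
  have 3: "?c -` C \<inter> ?c -` D = {}" if "C \<in> \<D>" "D \<in> \<D>" "C \<noteq> D" for C D
    using clique_model_disjoint[OF M that(1,2)] that(3) by blast
  have 4: "\<exists>x\<in>?c -` C. \<exists>y\<in>?c -` D. (x, y) \<in> E" if CD: "C \<in> \<D>" "D \<in> \<D>" "C \<noteq> D" for C D
  proof -
    obtain x y where "x \<in> C" "y \<in> D" "(x, y) \<in> collapse_rel u v E"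
      using clique_model_adjacent[OF M CD] by blast
    then show ?thesis unfolding collapse_rel_def by auto
  qed
  show "clique_model E V ((-`) ?c ` \<D>)" "card ((-`) ?c ` \<D>) = card \<D>"
    using clique_model_image[of \<D> "(-`) ?c", OF 1 2 3 4] by simp_all
  have "?c z = z" if "z \<in> Z" for z using that r(2) by (auto simp: collapse_def)
  then show "rooted Z ((-`) ?c ` \<D>)" using r(1) unfolding rooted_def by fastforce
qed

section \<open>Rooting a \<open>K\<^sub>5\<close>-model at a triangle\<close>

text \<open>This repairs the model \<open>{a, b}\<close>, \<open>{c}\<close>, \<open>{p}\<close>,
  \<open>{q}\<close>, \<open>{r}\<close>: the pair is split, \<open>b\<close> stands alone because
  it sees both \<open>q\<close> and \<open>r\<close>, and \<open>a\<close> joins its neighbour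
  \<open>p\<close>.\<close>

lemma model_from_pair:
  assumes "sym E" "distinct [a, b, c, p, q, r]" "{a, b, c, p, q, r} \<subseteq> V"
    and "(a, b) \<in> E" "(a, c) \<in> E" "(b, c) \<in> E" "(p, q) \<in> E" "(p, r) \<in> E" "(q, r) \<in> E"
    and "(c, p) \<in> E" "(c, q) \<in> E" "(c, r) \<in> E" "(a, p) \<in> E" "(b, q) \<in> E" "(b, r) \<in> E"
  shows "\<exists>\<D>. clique_model E V \<D> \<and> card \<D> = 5 \<and> rooted {a, b, c} \<D>"
proof -
  let ?D = "{{a, p}, {b}, {c}, {q}, {r}}"
  have "conn E {a, p}" using assms(1,13) by (rule conn_pair)
  moreover have "pairwise disjnt ?D" using assms(2) by (auto simp: pairwise_insert)
  moreover have "\<forall>B\<in>?D. \<forall>C\<in>?D. B \<noteq> C \<longrightarrow> (\<exists>x\<in>B. \<exists>y\<in>C. (x, y) \<in> E)"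
    using assms(4-15) assms(4-15)[THEN symD[OF assms(1)]] by simp
  ultimately have "clique_model E V ?D" using assms(3) by (simp add: clique_model_def)
  moreover have "card ?D = 5" using assms(2) by (simp add: doubleton_eq_iff)
  moreover have "rooted {a, b, c} ?D" using assms(2) by (auto simp: rooted_def)
  ultimately show ?thesis by blast
qed

text \<open>This repairs the model \<open>{a, b, c}\<close>, \<open>{p}\<close>, \<open>{q}\<close>,
  \<open>{r}\<close>, \<open>{s}\<close>: \<open>b\<close> and \<open>c\<close> join their partners
  \<open>q\<close> and \<open>r\<close>, while \<open>a\<close> stands alone because it sees both
  \<open>p\<close> and \<open>s\<close>.\<close>

lemma model_from_triple:
  assumes "sym E" "distinct [a, b, c, p, q, r, s]" "{a, b, c, p, q, r, s} \<subseteq> V"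
    and "(a, b) \<in> E" "(a, c) \<in> E" "(b, c) \<in> E"
    and "(p, q) \<in> E" "(p, r) \<in> E" "(p, s) \<in> E" "(q, r) \<in> E" "(q, s) \<in> E" "(r, s) \<in> E"
    and "(a, p) \<in> E" "(b, q) \<in> E" "(c, r) \<in> E" "(a, s) \<in> E"
  shows "\<exists>\<D>. clique_model E V \<D> \<and> card \<D> = 5 \<and> rooted {a, b, c} \<D>"
proof -
  let ?D = "{{a}, {b, q}, {c, r}, {p}, {s}}"
  have "conn E {b, q}" "conn E {c, r}" using assms(1,14,15) by (simp_all add: conn_pair)
  moreover have "pairwise disjnt ?D" using assms(2) by (auto simp: pairwise_insert)
  moreover have "\<forall>B\<in>?D. \<forall>C\<in>?D. B \<noteq> C \<longrightarrow> (\<exists>x\<in>B. \<exists>y\<in>C. (x, y) \<in> E)"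
    using assms(4-16) assms(4-16)[THEN symD[OF assms(1)]] by simp
  ultimately have "clique_model E V ?D" using assms(3) by (simp add: clique_model_def)
  moreover have "card ?D = 5" using assms(2) by (auto simp: card_insert_if doubleton_eq_iff)
  moreover have "rooted {a, b, c} ?D" using assms(2) by (auto simp: rooted_def)
  ultimately show ?thesis by blast
qed

text \<open>The situation in which no edge can be contracted without losing the model or the triangle.\<close>

locale irreducible_model =
  fixes E :: "('a \<times> 'a) set" and V Z :: "'a set" and \<B> :: "'a set set"
  assumes fin: "finite V" and EV: "E \<subseteq> V \<times> V" and symE: "sym E"
    and ZV: "Z \<subseteq> V" and cZ: "card Z = 3"
    and tri: "\<And>x y. x \<in> Z \<Longrightarrow> y \<in> Z \<Longrightarrow> x \<noteq> y \<Longrightarrow> (x, y) \<in> E"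
    and M: "clique_model E V \<B>" and cB: "card \<B> = 5" and t: "tied E V Z \<B>"
    and irred: "\<And>x y. (x, y) \<in> E \<Longrightarrow> x \<noteq> y \<Longrightarrow> x \<notin> Z \<or> y \<notin> Z \<Longrightarrow>
       \<exists>B\<in>\<B>. \<exists>C\<in>\<B>. B \<noteq> C \<and> x \<in> B \<and> y \<in> C"
begin

section \<open>Structure of an irreducible model\<close>

definition X where "X = \<Union>\<B> - Z"

lemma finZ: "finite Z" using cZ by (simp add: card_ge_0_finite)

lemma disj: "pairwise disjnt \<B>" using M by (simp add: clique_model_def)

lemma XV: "X \<subseteq> V" using clique_modelD(1)[OF M] unfolding X_def by blast

text \<open>Otherwise connectedness gives an edge at \<open>x\<close> inside \<open>B\<close>,
  although every edge not inside \<open>Z\<close> joins two different branch sets.\<close>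

lemma off_root_singleton:
  assumes B: "B \<in> \<B>" "x \<in> B" "x \<notin> Z"
  shows "B = {x}"
proof (rule ccontr)
  assume "B \<noteq> {x}"
  then have "{x} \<subset> B" using B by blast
  then obtain y where y: "y \<in> B" "y \<noteq> x" "(x, y) \<in> E"
    using connD[OF clique_modelD(2)[OF M B(1)]] by (metis DiffE insert_not_empty singletonD singletonI)
  then obtain C D where CD: "C \<in> \<B>" "D \<in> \<B>" "C \<noteq> D" "x \<in> C" "y \<in> D" using irred B(3) by metis
  have "C = B" "D = B"
    using clique_model_disjoint[OF M CD(1) B(1) CD(4) B(2)]
      clique_model_disjoint[OF M CD(2) B(1) CD(5) y(1)] by simp_all
  then show False using CD(3) by simp
qed

lemma singleton_mem: "x \<in> X \<Longrightarrow> {x} \<in> \<B>"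
  using off_root_singleton unfolding X_def by blast

lemma root_or_singleton:
  assumes "B \<in> \<B>"
  shows "B \<subseteq> Z \<or> (\<exists>x\<in>X. B = {x})"
proof (cases "B \<subseteq> Z")
  case False
  then obtain x where x: "x \<in> B" "x \<notin> Z" by blast
  then have "x \<in> X" using assms unfolding X_def by blast
  then show ?thesis using off_root_singleton[OF assms x] by blast
qed simp

lemma neighbour_in_X: "(z, x) \<in> E \<Longrightarrow> z \<noteq> x \<Longrightarrow> x \<notin> Z \<Longrightarrow> x \<in> X"
  using irred[of z x] unfolding X_def by blast

lemma X_clique:
  assumes "x \<in> X" "y \<in> X" "x \<noteq> y"
  shows "(x, y) \<in> E"
  using clique_model_adjacent[OF M singleton_mem[OF assms(1)] singleton_mem[OF assms(2)]] assms(3)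
  by auto

lemma X_adjacent:
  assumes "B \<in> \<B>" "B \<subseteq> Z" "x \<in> X"
  obtains z where "z \<in> B" "(z, x) \<in> E"
proof -
  have "B \<noteq> {x}" using assms unfolding X_def by blast
  then show thesis
    using clique_model_adjacent[OF M assms(1) singleton_mem[OF assms(3)]] that by blast
qed

text \<open>If \<open>z\<close> lies in no branch set, its only neighbours besides itself are in
  \<open>Z\<close>. Then \<open>Z - {z}\<close> separates \<open>Z\<close> and all uncovered
  vertices from the branch vertices off \<open>Z\<close>; it has order 2, and one of the five branch
  sets misses \<open>Z\<close>, against tiedness.\<close>

lemma roots_covered: "Z \<subseteq> \<Union>\<B>"
proof (rule ccontr)
  assume "\<not> Z \<subseteq> \<Union>\<B>"
  then obtain z where z: "z \<in> Z" "z \<notin> \<Union>\<B>" by blast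
  let ?P = "Z \<union> (V - \<Union>\<B>)" and ?Q = "(Z - {z}) \<union> \<Union>\<B>"
  have UV: "\<Union>\<B> \<subseteq> V" using clique_modelD(1)[OF M] by blast
  have "(x, y) \<notin> E" if "x \<in> ?P - ?Q" "y \<in> ?Q - ?P" for x y
    using that irred[of x y] by blast
  then have s: "separation E V ?P ?Q" using UV ZV z unfolding separation_def by blast
  have "\<exists>B\<in>\<B>. B \<inter> Z = {}"
    using card_disjoint_le[OF finZ disj] cB cZ by fastforce
  then obtain B where B: "B \<in> \<B>" "B \<inter> Z = {}" by blast
  then have "B \<subseteq> ?Q - ?P" by blast
  then have "card Z \<le> card (?P \<inter> ?Q)" using tiedD[OF t s _ B(1)] by blast
  also have "?P \<inter> ?Q = Z - {z}" using z by blast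
  finally show False using z(1) finZ by (simp add: card_gt_0_iff card_Diff_singleton_if)
     (use cZ in simp)
qed

lemma card_roots_X: "card {B \<in> \<B>. B \<subseteq> Z} + card X = 5"
proof -
  have "\<B> = {B \<in> \<B>. B \<subseteq> Z} \<union> (\<lambda>x. {x}) ` X"
    using root_or_singleton singleton_mem by blast
  moreover have "{B \<in> \<B>. B \<subseteq> Z} \<inter> (\<lambda>x. {x}) ` X = {}" unfolding X_def by blast
  moreover have "finite \<B>" using cB by (simp add: card_ge_0_finite)
  ultimately have "card \<B> = card {B \<in> \<B>. B \<subseteq> Z} + card ((\<lambda>x. {x}) ` X)"
    using card_Un_disjoint by (metis finite_Un)
  then show ?thesis using cB by (simp add: card_image)
qed

text \<open>Menger's theorem between \<open>Z\<close> and \<open>X\<close>: a separator either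
  contains \<open>X\<close>, or leaves a singleton branch set strictly behind it, where tiedness
  bounds its order.\<close>

lemma matching:
  assumes "card X \<ge> 3"
  obtains m where "inj_on m Z" "m ` Z \<subseteq> X" "\<And>z. z \<in> Z \<Longrightarrow> (z, m z) \<in> E"
proof -
  have "3 \<le> card (P \<inter> Q)" if s: "separation E V P Q" and PQ: "Z \<subseteq> P" "X \<subseteq> Q" for P Q
  proof (cases "X \<subseteq> P")
    case True
    have "P \<inter> Q \<subseteq> V" using s unfolding separation_def by blast
    then have "finite (P \<inter> Q)" using fin finite_subset by blast
    then have "card X \<le> card (P \<inter> Q)" using True PQ by (intro card_mono) auto
    then show ?thesis using assms by simp
  next
    case False
    then obtain x where "x \<in> X" "x \<notin> P" by blast
    then show ?thesis using tiedD[OF t s PQ(1) singleton_mem[of x]] PQ(2) cZ by auto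
  qed
  then obtain \<L> where L: "linkage E V Z X \<L>" "card \<L> = 3"
    using menger[OF fin EV symE ZV XV] by metis
  have "Z \<noteq> {}" using cZ by auto
  then obtain d where d: "d ` Z = \<L>" "\<And>z. z \<in> Z \<Longrightarrow> d z \<inter> Z = {z}"
    using disjoint_transversal[of Z \<L>] finZ L cZ unfolding linkage_def by metis
  \<comment> \<open>The member through \<open>z\<close> has no other root but reaches
    \<open>X\<close>, so the cut \<open>{z}\<close> gives a neighbour off \<open>Z\<close>, and such
    neighbours lie in \<open>X\<close>. Linkage members thus shrink to single edges.\<close>
  have "\<exists>x. x \<in> X \<and> x \<in> d z \<and> (z, x) \<in> E" if z: "z \<in> Z" for z
  proof -
    have D: "d z \<in> \<L>" using d(1) z by blast
    have "{z} \<subset> d z" using d(2)[OF z] linkageD(4)[OF L(1) D] unfolding X_def using z by blast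
    then obtain x where x: "x \<in> d z" "x \<noteq> z" "(z, x) \<in> E"
      using connD[OF linkageD(2)[OF L(1) D]] by (metis DiffE insert_not_empty singletonD singletonI)
    then have "x \<notin> Z" using d(2)[OF z] by blast
    then show ?thesis using neighbour_in_X x by blast
  qed
  then obtain m where m: "\<And>z. z \<in> Z \<Longrightarrow> m z \<in> X \<and> m z \<in> d z \<and> (z, m z) \<in> E" by metis
  have "inj_on m Z"
  proof (rule inj_onI)
    fix x y assume xy: "x \<in> Z" "y \<in> Z" "m x = m y"
    have D: "d x \<in> \<L>" "d y \<in> \<L>" using d(1) xy by blast+
    have "m x \<in> d x \<inter> d y" using m[OF xy(1)] m[OF xy(2)] xy(3) by simp
    then have "d x = d y" using linkage_disjoint[OF L(1) D] by blast
    then show "x = y" using d(2)[OF xy(1)] d(2)[OF xy(2)] by (metis singleton_inject)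
  qed
  then show thesis using that m by blast
qed

lemma rooted_of_pair:
  assumes Z: "Z = {a, b, c}" "distinct [a, b, c]" and B: "{a, b} \<in> \<B>" "{c} \<in> \<B>"
  shows "\<exists>\<D>. clique_model E V \<D> \<and> card \<D> = 5 \<and> rooted Z \<D>"
proof -
  have "B = {a, b} \<or> B = {c}" if BB: "B \<in> \<B>" "B \<subseteq> Z" for B
  proof -
    obtain x where x: "x \<in> B" "x \<in> Z" using clique_modelD(3)[OF M BB(1)] BB(2) by blast
    then show ?thesis
      using Z(1) clique_model_disjoint[OF M BB(1) B(1), of x] clique_model_disjoint[OF M BB(1) B(2), of x]
      by blast
  qed
  then have "{B \<in> \<B>. B \<subseteq> Z} = {{a, b}, {c}}" using B Z by auto
  moreover have "card {{a, b}, {c}} = 2" using Z(2) by (simp add: doubleton_eq_iff)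
  ultimately have cX: "card X = 3" using card_roots_X by simp
  obtain m where m: "inj_on m Z" "m ` Z \<subseteq> X" "\<And>z. z \<in> Z \<Longrightarrow> (z, m z) \<in> E"
    using matching cX by auto
  have mX: "m a \<in> X" "m b \<in> X" "m c \<in> X" using m(2) Z(1) by auto
  have dm: "distinct [m a, m b, m c]" using m(1) Z by (auto simp: inj_on_def)
  have dist: "distinct [a, b, c, m a, m b, m c]" "distinct [b, a, c, m b, m a, m c]"
    using dm Z mX unfolding X_def by auto
  have c: "(c, x) \<in> E" if "x \<in> X" for x using X_adjacent[OF B(2) _ that] Z(1) by blast
  have V: "{a, b, c, m a, m b, m c} \<subseteq> V" using ZV Z(1) mX XV by blast
  have Z': "(a, b) \<in> E" "(b, a) \<in> E" "(a, c) \<in> E" "(b, c) \<in> E" "(a, m a) \<in> E" "(b, m b) \<in> E"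
    using Z tri m(3) by auto
  have X': "(m a, m b) \<in> E" "(m b, m a) \<in> E" "(m a, m c) \<in> E" "(m b, m c) \<in> E"
    using X_clique mX dm by auto
  \<comment> \<open>The branch set \<open>{a, b}\<close> must be adjacent to \<open>{m c}\<close>.
    Whichever of \<open>a\<close> and \<open>b\<close> sees \<open>m c\<close> becomes a branch set
    of its own, and the other joins its partner.\<close>
  have "(a, m c) \<in> E \<or> (b, m c) \<in> E" using X_adjacent[OF B(1) _ mX(3)] Z(1) by blast
  then show ?thesis
  proof
    assume "(b, m c) \<in> E"
    then show ?thesis
      using model_from_pair[OF symE dist(1) V] Z' X' c[OF mX(1)] c[OF mX(2)] c[OF mX(3)] Z(1) by simp
  next
    assume "(a, m c) \<in> E"
    then show ?thesis
      using model_from_pair[OF symE dist(2)] V Z' X' c[OF mX(1)] c[OF mX(2)] c[OF mX(3)] Z(1)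
      by (simp add: insert_commute)
  qed
qed

lemma rooted_of_triple:
  assumes B: "Z \<in> \<B>"
  shows "\<exists>\<D>. clique_model E V \<D> \<and> card \<D> = 5 \<and> rooted Z \<D>"
proof -
  have "B = Z" if BB: "B \<in> \<B>" "B \<subseteq> Z" for B
    using clique_modelD(3)[OF M BB(1)] BB(2) clique_model_disjoint[OF M BB(1) B] by blast
  then have "{B \<in> \<B>. B \<subseteq> Z} = {Z}" using B by auto
  then have cX: "card X = 4" using card_roots_X by simp
  obtain m where m: "inj_on m Z" "m ` Z \<subseteq> X" "\<And>z. z \<in> Z \<Longrightarrow> (z, m z) \<in> E"
    using matching cX by auto
  have "card (m ` Z) = 3" using m(1) cZ by (simp add: card_image)
  then have "m ` Z \<noteq> X" using cX by auto
  \<comment> \<open>\<open>s\<close> is the one vertex of \<open>X\<close> left unmatched; the root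
    adjacent to it plays the part of \<open>a\<close>.\<close>
  then obtain s where s: "s \<in> X" "s \<notin> m ` Z" using m(2) by blast
  obtain a where a: "a \<in> Z" "(a, s) \<in> E" using X_adjacent[OF B _ s(1)] by blast
  have "card (Z - {a}) = 2" using a(1) cZ finZ by simp
  then obtain b c where bc: "Z - {a} = {b, c}" "b \<noteq> c" by (auto simp: card_2_iff)
  then have Z: "Z = {a, b, c}" "distinct [a, b, c]" using a(1) by auto
  have mX: "m a \<in> X" "m b \<in> X" "m c \<in> X" using m(2) Z(1) by auto
  have dm: "distinct [m a, m b, m c, s]" using m(1) Z s(2) by (auto simp: inj_on_def)
  have dist: "distinct [a, b, c, m a, m b, m c, s]" using dm Z mX s(1) unfolding X_def by auto
  have V: "{a, b, c, m a, m b, m c, s} \<subseteq> V" using ZV Z(1) mX s(1) XV by blast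
  have Z': "(a, b) \<in> E" "(a, c) \<in> E" "(b, c) \<in> E" "(a, m a) \<in> E" "(b, m b) \<in> E" "(c, m c) \<in> E"
    using Z tri m(3) by auto
  have X': "(m a, m b) \<in> E" "(m a, m c) \<in> E" "(m a, s) \<in> E" "(m b, m c) \<in> E" "(m b, s) \<in> E" "(m c, s) \<in> E"
    using X_clique mX s(1) dm by auto
  show ?thesis using model_from_triple[OF symE dist V] Z' X' a(2) Z(1) by simp
qed

text \<open>A branch set with two roots cannot be a singleton off \<open>Z\<close>, so it lies
  inside \<open>Z\<close>. The third root either belongs to it or is a branch set by itself.\<close>

lemma rooted_model: "\<exists>\<D>. clique_model E V \<D> \<and> card \<D> = 5 \<and> rooted Z \<D>"
proof (cases "rooted Z \<B>")
  case True
  then show ?thesis using M cB by blast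
next
  case False
  then obtain B a b where B: "B \<in> \<B>" "a \<in> B" "b \<in> B" "a \<in> Z" "b \<in> Z" "a \<noteq> b"
    using roots_covered unfolding rooted_def by blast
  then have BZ: "B \<subseteq> Z" using root_or_singleton[OF B(1)] by blast
  have "card (Z - {a, b}) = 1" using B cZ finZ by (simp add: card_Diff_subset)
  then obtain c where "Z - {a, b} = {c}" by (auto simp: card_1_singleton_iff)
  then have Z: "Z = {a, b, c}" "distinct [a, b, c]" using B by auto
  show ?thesis
  proof (cases "c \<in> B")
    case True
    then have "B = Z" using Z B BZ by blast
    then show ?thesis using rooted_of_triple B(1) by simp
  next
    case False
    then have Bab: "B = {a, b}" using Z B BZ by blast
    obtain C where C: "C \<in> \<B>" "c \<in> C" using roots_covered Z(1) by blast
    then have "C \<noteq> B" using False by blast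
    then have "a \<notin> C" "b \<notin> C" using clique_model_disjoint[OF M C(1) B(1)] B by blast+
    moreover have "C \<subseteq> Z" using root_or_singleton[OF C(1)] C(2) Z(1) unfolding X_def by blast
    ultimately have "C = {c}" using Z(1) C(2) by blast
    then show ?thesis using rooted_of_pair[OF Z] Bab B(1) C(1) by simp
  qed
qed

end

theorem rooted_K5_model:
  assumes "finite V" "E \<subseteq> V \<times> V" "sym E" "Z \<subseteq> V" "card Z = 3"
    and "\<And>x y. x \<in> Z \<Longrightarrow> y \<in> Z \<Longrightarrow> x \<noteq> y \<Longrightarrow> (x, y) \<in> E"
    and "clique_model E V \<B>" "card \<B> = 5" "tied E V Z \<B>"
  shows "\<exists>\<D>. clique_model E V \<D> \<and> card \<D> = 5 \<and> rooted Z \<D>"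
  using assms
proof (induction "card V" arbitrary: V E Z \<B> rule: less_induct)
  case less
  note fin = less.prems(1) and EV = less.prems(2) and symE = less.prems(3) and ZV = less.prems(4)
    and cZ = less.prems(5) and tri = less.prems(6) and M = less.prems(7) and cB = less.prems(8)
    and t = less.prems(9)
  have finZ: "finite Z" and Zne: "Z \<noteq> {}" using cZ by (auto simp: card_ge_0_finite)
  have split: ?case
    if sep: "separation E V P Q" and PQ: "card (P \<inter> Q) = 3" "Z \<subseteq> P" "P \<noteq> Z"
      and B0: "B0 \<in> \<B>" "B0 \<subseteq> Q - P" for P Q B0
  proof -
    have PQV: "P \<union> Q = V" using sep by (simp add: separation_def)
    then have fins: "finite P" "finite Q" using fin by auto
    \<comment> \<open>Here \<open>P \<noteq> Z\<close> forces \<open>P\<close> to have more than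
      three vertices, so \<open>P\<close> is not inside \<open>Q\<close> and the induction
      hypothesis applies to \<open>Q\<close>.\<close>
    have "card (P \<inter> Q) < card P" using PQ fins cZ psubset_card_mono[of P Z] by auto
    then have "\<not> P \<subseteq> Q" by (metis Int_absorb2 less_irrefl)
    then have "Q \<noteq> V" using PQV by blast
    then have cQ: "card Q < card V" using PQV fin by (intro psubset_card_mono) auto
    define F where "F = E \<inter> Q \<times> Q \<union> (P \<inter> Q) \<times> (P \<inter> Q)"
    have F: "F \<subseteq> Q \<times> Q" "sym F" using symE unfolding F_def sym_def by auto
    have cPZ: "card (P \<inter> Q) = card Z" using PQ cZ by simp
    note res = clique_model_restrict[OF EV symE M t sep PQ(2) cPZ B0 F_def]
    have "\<exists>\<D>. clique_model F Q \<D> \<and> card \<D> = 5 \<and> rooted (P \<inter> Q) \<D>"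
      using res(2) cB
      by (intro less.hyps[OF cQ fins(2) F Int_lower2 PQ(1) _ res(1) _ res(3)]) (auto simp: F_def)
    then obtain \<C> where C: "clique_model F Q \<C>" "card \<C> = 5" "rooted (P \<inter> Q) \<C>" by blast
    \<comment> \<open>A small separator of \<open>Z\<close> from \<open>P \<inter> Q\<close> within
      \<open>P\<close> would, with \<open>Q\<close> added behind it, have \<open>B0\<close> strictly
      on its far side, against tiedness.\<close>
    have "\<exists>\<L>. linkage (E \<inter> P \<times> P) P Z (P \<inter> Q) \<L> \<and> card \<L> = card Z"
    proof (rule menger[OF fins(1)])
      show "sym (E \<inter> P \<times> P)" using symE unfolding sym_def by blast
      fix R S assume R: "separation (E \<inter> P \<times> P) P R S" "Z \<subseteq> R" "P \<inter> Q \<subseteq> S"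
      have s: "separation E V R (S \<union> Q)" "R \<inter> (S \<union> Q) = R \<inter> S"
        using separation_refine[OF sep symE EV R(1,3)] by blast+
      have "R \<subseteq> P" using R(1) unfolding separation_def by blast
      then have "B0 \<subseteq> (S \<union> Q) - R" using B0(2) by blast
      then show "card Z \<le> card (R \<inter> S)" using tiedD[OF t s(1) R(2) B0(1)] s(2) by simp
    qed (use PQ in auto)
    then obtain \<L> where L: "linkage (E \<inter> P \<times> P) P Z (P \<inter> Q) \<L>" "card \<L> = card Z" by blast
    have "conn E D" if "D \<in> \<L>" for D using linkageD(2)[OF L(1) that] by (rule conn_mono) simp
    then have L': "linkage E P Z (P \<inter> Q) \<L>" using L(1) unfolding linkage_def by blast
    have "P \<subseteq> V" "Q \<subseteq> V" using PQV by auto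
    then show ?case
      using rooted_model_extend[OF EV symE _ _ fins(1) PQ(2) cPZ Zne tri C(1)[unfolded F_def] C(3) L' L(2)]
        C(2) by simp
  qed
  have contract: ?case
    if uv: "(u, v) \<in> E" "u \<noteq> v" "v \<notin> Z"
      and no: "\<And>B C. B \<in> \<B> \<Longrightarrow> C \<in> \<B> \<Longrightarrow> u \<in> B \<Longrightarrow> v \<in> C \<Longrightarrow> B = C" for u v
  proof -
    let ?c = "collapse u v" and ?E = "collapse_rel u v E" and ?V = "V - {v}"
    let ?B = "(`) ?c ` \<B>"
    have V: "u \<in> V" "v \<in> V" using uv EV by auto
    note col = clique_model_collapse[OF M V uv(2) no]
    have cV: "card ?V < card V" using V fin by (meson card_Diff1_less)
    show ?case
    proof (cases "tied ?E ?V Z ?B")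
      case True
      have "\<exists>\<D>. clique_model ?E ?V \<D> \<and> card \<D> = 5 \<and> rooted Z \<D>"
      proof (rule less.hyps[OF cV _ collapse_rel_subset[OF EV V(1) uv(2)] collapse_rel_sym[OF symE]
            _ cZ _ col(1) _ True])
        show "(x, y) \<in> ?E" if "x \<in> Z" "y \<in> Z" "x \<noteq> y" for x y
        proof -
          have "?c x = x" "?c y = y" using that uv(3) by (auto simp: collapse_def)
          then show ?thesis using collapse_relI[OF tri[OF that], of u v] by simp
        qed
      qed (use fin ZV uv(3) col(2) cB in auto)
      then obtain \<D> where D: "clique_model ?E ?V \<D>" "card \<D> = 5" "rooted Z \<D>" by blast
      show ?thesis
        using clique_model_vimage_collapse[OF D(1) symE uv(1) V(2) D(3) uv(3)] D(2) by metis
    next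
      case False
      then obtain P' Q' B where s': "separation ?E ?V P' Q'" "Z \<subseteq> P'" "B \<in> \<B>" "?c ` B \<subseteq> Q' - P'"
          "card (P' \<inter> Q') < card Z"
        unfolding tied_def by (auto simp: not_le)
      let ?P = "?c -` P'" and ?Q = "?c -` Q'"
      have s: "separation E V ?P ?Q" by (rule separation_vimage_collapse[OF s'(1) V uv(2)])
      have Z: "Z \<subseteq> ?P" using s'(2) uv(3) by (auto simp: collapse_def)
      have B: "B \<subseteq> ?Q - ?P" using s'(4) by blast
      have "P' \<inter> Q' \<subseteq> V" using s'(1) unfolding separation_def by blast
      then have f: "finite (P' \<inter> Q')" using fin finite_subset by blast
      have X: "?P \<inter> ?Q = ?c -` (P' \<inter> Q')" by simp
      have "card Z \<le> card (?P \<inter> ?Q)" by (rule tiedD[OF t s Z s'(3) B])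
      moreover have "card (?P \<inter> ?Q) \<le> Suc (card (P' \<inter> Q'))"
          "u \<notin> P' \<inter> Q' \<Longrightarrow> card (?P \<inter> ?Q) \<le> card (P' \<inter> Q')"
        unfolding X by (rule card_vimage_collapse[OF f])+
      \<comment> \<open>The lifted order is at least 3 and at most one more than an order below 3.
        So it is exactly 3, and \<open>v\<close> enters the separator together with
        \<open>u\<close>; as \<open>v\<close> is not in \<open>Z\<close>, this yields
        \<open>?P \<noteq> Z\<close>.\<close>
      ultimately have "u \<in> P' \<inter> Q'" "card (?P \<inter> ?Q) = 3" using s'(5) cZ by linarith+
      then have "v \<in> ?P" by (simp add: collapse_def)
      then have "?P \<noteq> Z" using uv(3) by blast
      then show ?thesis using split[OF s \<open>card (?P \<inter> ?Q) = 3\<close> Z _ s'(3) B] by blast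
    qed
  qed
  show ?case
  proof (rule ccontr)
    assume no: "\<not> ?case"
    have "irreducible_model E V Z \<B>"
    proof
      fix x y assume xy: "(x, y) \<in> E" "x \<noteq> y" "x \<notin> Z \<or> y \<notin> Z"
      \<comment> \<open>Either orientation of the edge may be contracted, as long as the vertex that
        disappears is off \<open>Z\<close>.\<close>
      show "\<exists>B\<in>\<B>. \<exists>C\<in>\<B>. B \<noteq> C \<and> x \<in> B \<and> y \<in> C"
        using contract[OF xy(1,2)] contract[OF symD[OF symE xy(1)]] xy(2,3) no by metis
    qed (use less.prems in auto)
    then show False using irreducible_model.rooted_model no by blast
  qed
qed

section \<open>Minors and clique models\<close>

lemma sym_joined_by: "sym (joined_by G C)"
  unfolding joined_by_def sym_def by (auto simp: insert_commute)

lemma joined_by_mono: "C \<subseteq> D \<Longrightarrow> (\<And>e. e \<in> C \<Longrightarrow> ends G e = ends H e) \<Longrightarrow> joined_by G C \<subseteq> joined_by H D"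
  unfolding joined_by_def by fastforce

lemma joined_by_vertices:
  assumes "graph G" "C \<subseteq> edges G"
  shows "joined_by G C \<subseteq> vertices G \<times> vertices G"
proof (rule subrelI)
  fix x y assume "(x, y) \<in> joined_by G C"
  then obtain e where e: "e \<in> C" "ends G e = {x, y}" unfolding joined_by_def by blast
  then have "ends G e \<subseteq> vertices G" using assms unfolding graph_def by blast
  then show "(x, y) \<in> vertices G \<times> vertices G" using e(2) by simp
qed

lemma ends_pair:
  assumes "graph G" "e \<in> edges G" "x \<in> ends G e" "y \<in> ends G e" "x \<noteq> y"
  shows "ends G e = {x, y}"
proof -
  have "card (ends G e) \<in> {1, 2}" using assms(1,2) unfolding graph_def by blast
  then have "finite (ends G e)" "card (ends G e) \<le> card {x, y}"
    using assms(5) card.infinite by fastforce+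
  then show ?thesis using assms(3,4) card_seteq[of "ends G e" "{x, y}"] by simp
qed

lemma component_mem: "x \<in> vertices H \<Longrightarrow> x \<in> component H C x"
  unfolding component_def by simp

lemma component_eq:
  assumes "w \<in> component H C x"
  shows "component H C w = component H C x"
proof -
  have "(x, w) \<in> (joined_by H C)\<^sup>*" using assms unfolding component_def by simp
  moreover from this have "(w, x) \<in> (joined_by H C)\<^sup>*"
    using sym_rtrancl[OF sym_joined_by] by (metis symD)
  ultimately show ?thesis unfolding component_def by (auto intro: rtrancl_trans)
qed

text \<open>This passes from reachability to cuts: a subset of the component that no edge of
  \<open>C\<close> leaves contains everything reachable from its vertices.\<close>

lemma conn_component:
  assumes "graph H" "C \<subseteq> edges H" "x \<in> vertices H"
  shows "conn (joined_by H C) (component H C x)"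
  unfolding conn_def
proof (intro conjI allI impI)
  show "component H C x \<noteq> {}" using component_mem[OF assms(3)] by blast
  fix S assume S: "S \<subset> component H C x" "S \<noteq> {}"
  then obtain s y where s: "s \<in> S" "y \<in> component H C x - S"
    by (meson all_not_in_conv psubset_imp_ex_mem)
  have "s \<in> component H C x" using S(1) s(1) by blast
  then have "component H C s = component H C x" by (rule component_eq)
  then have sy: "(s, y) \<in> (joined_by H C)\<^sup>*" using s unfolding component_def by blast
  show "\<exists>p\<in>S. \<exists>q\<in>component H C x - S. (p, q) \<in> joined_by H C"
  proof (rule ccontr)
    assume no: "\<not> ?thesis"
    from sy have "y \<in> S"
    proof (induction rule: rtrancl_induct)
      case base
      then show ?case using s by simp
    next
      case (step p q)
      have "q \<in> vertices H" using joined_by_vertices[OF assms(1,2)] step(2) by blast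
      moreover have "(x, p) \<in> (joined_by H C)\<^sup>*" using step(3) S unfolding component_def by blast
      ultimately have "q \<in> component H C x"
        using step(2) unfolding component_def by (auto intro: rtrancl_into_rtrancl)
      then show ?case using no step by blast
    qed
    then show False using s by simp
  qed
qed

text \<open>The vertices of a contraction are themselves sets of vertices of \<open>G\<close>, so
  \<open>vertices N\<close> already is the family of branch sets.\<close>

lemma clique_model_of_minor:
  assumes G: "graph G" and "minor N G" and iso: "isomorphic N (complete_graph n)"
  shows "\<exists>\<B>. clique_model (joined_by G (edges G)) (vertices G) \<B> \<and> card \<B> = n"
proof -
  let ?E = "joined_by G (edges G)"
  obtain H C where H: "subgraph H G" "C \<subseteq> edges H" "N = contract H C"
    using assms(2) unfolding minor_def by blast
  have gH: "graph H" and HV: "vertices H \<subseteq> vertices G" and HE: "edges H \<subseteq> edges G"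
    and ends: "\<And>e. e \<in> edges H \<Longrightarrow> ends H e = ends G e"
    using H(1) unfolding subgraph_def by auto
  obtain f g where f: "bij_betw f (vertices N) {..<n}"
    and g: "bij_betw g (edges N) {e. e \<subseteq> {..<n} \<and> card e = 2}"
    and fg: "\<And>e. e \<in> edges N \<Longrightarrow> g e = f ` ends N e"
    using iso unfolding isomorphic_def complete_graph_def by auto
  have VN: "vertices N = component H C ` vertices H" and EN: "edges N = edges H - C"
    and dN: "\<And>e. ends N e = component H C ` ends H e"
    unfolding H(3) contract_def by simp_all
  have RE: "joined_by H C \<subseteq> ?E" using H(2) HE ends by (intro joined_by_mono) auto
  have cn: "card (vertices N) = n" using bij_betw_same_card[OF f] by simp
  have "clique_model ?E (vertices G) (vertices N)"
    unfolding clique_model_def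
  proof (intro conjI ballI impI)
    show "pairwise disjnt (vertices N)"
      unfolding VN by (rule pairwise_imageI) (metis component_eq disjnt_iff)
    fix A assume A: "A \<in> vertices N"
    then obtain x where x: "x \<in> vertices H" "A = component H C x" unfolding VN by blast
    show "A \<subseteq> vertices G" using HV unfolding x component_def by blast
    show "conn ?E A" unfolding x(2)
      using conn_component[OF gH H(2) x(1)] by (rule conn_mono) (use RE in blast)
    fix B assume B: "B \<in> vertices N" "A \<noteq> B"
    have inj: "inj_on f (vertices N)" using f by (simp add: bij_betw_def)
    have fA: "f A < n" "f B < n" using bij_betwE[OF f] A B by auto
    have "f A \<noteq> f B" using inj_onD[OF inj _ A B(1)] B(2) by blast
    then have "{f A, f B} \<in> {e. e \<subseteq> {..<n} \<and> card e = 2}" using fA by simp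
    then obtain e where e: "e \<in> edges N" "g e = {f A, f B}"
      using g unfolding bij_betw_def by (metis imageE)
    have eH: "e \<in> edges H" using e(1) EN by simp
    have sub: "ends N e \<subseteq> vertices N" using gH eH unfolding dN VN graph_def by blast
    have mem: "K \<in> ends N e" if K: "K \<in> vertices N" "f K \<in> {f A, f B}" for K
    proof -
      have "f K \<in> f ` ends N e" using K(2) e(2) fg[OF e(1)] by simp
      then show ?thesis using inj_on_image_mem_iff[OF inj K(1) sub] by simp
    qed
    have "A \<in> ends N e" "B \<in> ends N e" using mem A B by simp_all
    then obtain p q where pq: "p \<in> ends H e" "A = component H C p" "q \<in> ends H e" "B = component H C q"
      unfolding dN by blast
    have "p \<noteq> q" using pq B(2) by blast
    then have "ends H e = {p, q}" using ends_pair[OF gH eH pq(1,3)] by blast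
    then have "(p, q) \<in> ?E" using ends[OF eH] eH HE unfolding joined_by_def by auto
    moreover have "p \<in> vertices H" "q \<in> vertices H" using pq gH eH unfolding graph_def by blast+
    ultimately show "\<exists>x\<in>A. \<exists>y\<in>B. (x, y) \<in> ?E" using pq component_mem by metis
  qed
  then show ?thesis using cn by blast
qed

text \<open>Fewer than \<open>card Z\<close> vertices cannot contain \<open>Z\<close>, so some root
  is in \<open>P - Q\<close> while \<open>B\<close> is in \<open>Q - P\<close>; deleting
  \<open>P \<inter> Q\<close> would disconnect the graph.\<close>

lemma tied_of_k_connected:
  assumes G: "graph G" and k: "k_connected (card Z) G" and Z: "Z \<subseteq> vertices G"
    and M: "clique_model (joined_by G (edges G)) (vertices G) \<B>"
  shows "tied (joined_by G (edges G)) (vertices G) Z \<B>"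
  unfolding tied_def
proof (intro allI impI, rule ccontr)
  let ?E = "joined_by G (edges G)"
  fix P Q B
  assume s: "separation ?E (vertices G) P Q" and P: "Z \<subseteq> P" and B: "B \<in> \<B>" "B \<subseteq> Q - P"
    and "\<not> card Z \<le> card (P \<inter> Q)"
  then have less: "card (P \<inter> Q) < card Z" by simp
  have PQ: "P \<union> Q = vertices G" using s by (simp add: separation_def)
  have fin: "finite (vertices G)" using G by (simp add: graph_def)
  let ?D = "delete_vertices G (P \<inter> Q)"
  have "connected_graph ?D" using k less PQ unfolding k_connected_def by blast
  have "finite (P \<inter> Q)" using PQ fin by (metis finite_Int finite_Un)
  then have "\<not> Z \<subseteq> Q" using less P card_mono[of "P \<inter> Q" Z] by auto
  then obtain z where z: "z \<in> P" "z \<notin> Q" using P by blast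
  obtain y where y: "y \<in> Q" "y \<notin> P" using clique_modelD(3)[OF M B(1)] B(2) by blast
  have "z \<in> vertices ?D" "y \<in> vertices ?D" using z y PQ unfolding delete_vertices_def by auto
  then have "(z, y) \<in> (joined_by ?D (edges ?D))\<^sup>*"
    using \<open>connected_graph ?D\<close> unfolding connected_graph_def by blast
  then have "y \<in> P - Q"
  proof (induction rule: rtrancl_induct)
    case base
    then show ?case using z by simp
  next
    case (step p q)
    then obtain e where e: "e \<in> edges G" "ends G e = {p, q}" "{p, q} \<inter> (P \<inter> Q) = {}"
      unfolding joined_by_def delete_vertices_def by auto
    then have "(p, q) \<in> ?E" unfolding joined_by_def by blast
    then have "q \<in> P"
      using separation_edge(2)[OF s sym_joined_by joined_by_vertices[OF G]] step(3) by blast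
    then show ?case using e(3) by blast
  qed
  then show False using y by simp
qed

section \<open>Triangles, and minors with prescribed edges\<close>

lemma triangleE:
  assumes "triangle T G"
  obtains a b c d e f where "distinct [a, b, c]" "distinct [d, e, f]"
    "vertices T = {a, b, c}" "edges T = {d, e, f}" "{a, b, c} \<subseteq> vertices G" "{d, e, f} \<subseteq> edges G"
    "ends G d = {a, b}" "ends G e = {b, c}" "ends G f = {c, a}"
proof -
  obtain vs es where vs: "length vs = 3" "distinct vs" "vertices T = set vs"
    and es: "length es = 3" "distinct es" "edges T = set es"
    and inc: "\<And>i. i < 3 \<Longrightarrow> ends T (es ! i) = {vs ! i, vs ! (Suc i mod 3)}"
    using assms unfolding triangle_def is_cycle_def by blast
  obtain a b c where abc: "vs = [a, b, c]"
    using vs(1) by (auto simp: length_Suc_conv numeral_eq_Suc)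
  obtain d e f where def: "es = [d, e, f]"
    using es(1) by (auto simp: length_Suc_conv numeral_eq_Suc)
  have sub: "vertices T \<subseteq> vertices G" "edges T \<subseteq> edges G" "\<And>e. e \<in> edges T \<Longrightarrow> ends T e = ends G e"
    using assms unfolding triangle_def subgraph_def by auto
  have "ends T d = {a, b}" "ends T e = {b, c}" "ends T f = {c, a}"
    using inc[of 0] inc[of 1] inc[of 2] by (simp_all add: abc def)
  then have "ends G d = {a, b}" "ends G e = {b, c}" "ends G f = {c, a}"
    using sub(3) es(3) by (simp_all add: def)
  then show thesis
    using vs(2,3) es(2,3) sub(1,2) by (intro that[of a b c d e f]) (simp_all add: abc def)
qed

lemma triangleI:
  assumes "distinct [a, b, c]" "distinct [d, e, f]" "{a, b, c} \<subseteq> vertices G" "{d, e, f} \<subseteq> edges G"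
    "ends G d = {a, b}" "ends G e = {b, c}" "ends G f = {c, a}"
  shows "triangle \<lparr>vertices = {a, b, c}, edges = {d, e, f}, ends = ends G\<rparr> G"
proof -
  let ?T = "\<lparr>vertices = {a, b, c}, edges = {d, e, f}, ends = ends G\<rparr>"
  have "ends ?T ([d, e, f] ! i) = {[a, b, c] ! i, [a, b, c] ! (Suc i mod 3)}" if i: "i < 3" for i
  proof -
    consider "i = 0" | "i = 1" | "i = 2" using i by linarith
    then show ?thesis by cases (use assms(5-7) in simp_all)
  qed
  then have "is_cycle 3 ?T"
    unfolding is_cycle_def using assms(1,2)
    by (intro conjI exI[of _ "[a, b, c]"] exI[of _ "[d, e, f]"]) simp_all
  moreover have "graph ?T"
    using assms(1,5-7) unfolding graph_def by auto
  ultimately show ?thesis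
    using assms(3,4) unfolding triangle_def subgraph_def by simp
qed

text \<open>Used to pick one representing edge for every pair of branch sets while keeping those
  prescribed in \<open>R\<close>.\<close>

lemma extend_to_bij_betw:
  assumes "inj_on p R" "R \<subseteq> A" "p ` R \<subseteq> S" "S \<subseteq> p ` A"
  obtains R' where "R \<subseteq> R'" "R' \<subseteq> A" "bij_betw p R' S"
proof -
  obtain U where U: "U \<subseteq> A" "inj_on p U" "S - p ` R = p ` U"
    using assms(4) subset_image_inj[of "S - p ` R" p A] by (metis Diff_subset subset_trans)
  have "inj_on p (R \<union> U)" using assms(1) U(2,3) by (auto simp: inj_on_Un)
  moreover have "p ` (R \<union> U) = S" using U(3) assms(3) by blast
  ultimately show thesis using that[of "R \<union> U"] assms(2) U(1) by (simp add: bij_betw_def)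
qed

lemma bij_betw_pairs:
  assumes "bij_betw f A B"
  shows "bij_betw ((`) f) {p. p \<subseteq> A \<and> card p = 2} {q. q \<subseteq> B \<and> card q = 2}"
proof -
  have inj: "inj_on f A" and fA: "f ` A = B" using assms by (auto simp: bij_betw_def)
  have card: "card (f ` p) = card p" if "p \<subseteq> A" for p
    using card_image[OF inj_on_subset[OF inj that]] .
  have "inj_on ((`) f) {p. p \<subseteq> A \<and> card p = 2}"
    by (rule inj_on_subset[OF inj_on_image_Pow[OF inj]]) auto
  moreover have "(`) f ` {p. p \<subseteq> A \<and> card p = 2} = {q. q \<subseteq> B \<and> card q = 2}"
  proof (intro equalityI subsetI)
    fix q assume q: "q \<in> {q. q \<subseteq> B \<and> card q = 2}"
    then obtain p where "p \<subseteq> A" "q = f ` p" unfolding fA[symmetric] by (auto elim: subset_imageE)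
    then show "q \<in> (`) f ` {p. p \<subseteq> A \<and> card p = 2}" using q card by auto
  qed (use fA card in auto)
  ultimately show ?thesis by (simp add: bij_betw_def)
qed

definition branch_of :: "'a set set \<Rightarrow> 'a \<Rightarrow> 'a set" where
  "branch_of \<B> x = (THE B. B \<in> \<B> \<and> x \<in> B)"

lemma branch_of_eq:
  assumes "clique_model E V \<B>" "B \<in> \<B>" "x \<in> B"
  shows "branch_of \<B> x = B"
  unfolding branch_of_def using assms clique_model_disjoint by (metis (no_types, lifting) the_equality)

text \<open>All edges inside branch sets are contracted, and exactly one edge per pair of branch
  sets is kept, so the result has neither loops nor parallel edges. Edges of \<open>R\<close> can be
  among the kept ones because they represent different pairs.\<close>

lemma minor_of_clique_model:
  assumes G: "graph G" and M: "clique_model (joined_by G (edges G)) (vertices G) \<B>"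
    and fin: "finite \<B>" and R: "R \<subseteq> edges G" "\<And>e. e \<in> R \<Longrightarrow> ends G e \<subseteq> \<Union>\<B>"
    and inj: "inj_on (\<lambda>e. branch_of \<B> ` ends G e) R"
    and two: "\<And>e. e \<in> R \<Longrightarrow> card (branch_of \<B> ` ends G e) = 2"
  shows "\<exists>N. minor N G \<and> isomorphic N (complete_graph (card \<B>)) \<and> vertices N = \<B> \<and>
    R \<subseteq> edges N \<and> (\<forall>e\<in>edges N. ends N e = branch_of \<B> ` ends G e)"
proof -
  let ?E = "joined_by G (edges G)"
  let ?b = "branch_of \<B>"
  note b = branch_of_eq[OF M]
  let ?p = "\<lambda>e. ?b ` ends G e"
  let ?A = "{e \<in> edges G. ends G e \<subseteq> \<Union>\<B>}"
  let ?S = "{p. p \<subseteq> \<B> \<and> card p = 2}"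
  have bm: "?b x \<in> \<B>" "x \<in> ?b x" if "x \<in> \<Union>\<B>" for x using b that by auto
  have onto: "?S \<subseteq> ?p ` ?A"
  proof
    fix p assume "p \<in> ?S"
    then obtain B C where BC: "p = {B, C}" "B \<in> \<B>" "C \<in> \<B>" "B \<noteq> C" by (auto simp: card_2_iff)
    then obtain x y where xy: "x \<in> B" "y \<in> C" "(x, y) \<in> ?E"
      using clique_model_adjacent[OF M] by metis
    then obtain e where e: "e \<in> edges G" "ends G e = {x, y}" unfolding joined_by_def by blast
    then have "p = ?p e" using b[OF BC(2) xy(1)] b[OF BC(3) xy(2)] BC(1) by simp
    moreover have "e \<in> ?A" using e BC(2,3) xy(1,2) by auto
    ultimately show "p \<in> ?p ` ?A" by (rule image_eqI)
  qed
  have into: "?p ` R \<subseteq> ?S"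
  proof (rule image_subsetI)
    fix e assume "e \<in> R"
    then show "?p e \<in> ?S" using two[of e] R(2)[of e] bm(1) by auto
  qed
  have RA: "R \<subseteq> ?A" using R by auto
  obtain R' where R': "R \<subseteq> R'" "R' \<subseteq> ?A" "bij_betw ?p R' ?S"
    by (rule extend_to_bij_betw[OF inj RA into onto])
  define C where "C = {e \<in> edges G. \<exists>B\<in>\<B>. ends G e \<subseteq> B}"
  define H where "H = \<lparr>vertices = \<Union>\<B>, edges = C \<union> R', ends = ends G\<rparr>"
  have H: "vertices H = \<Union>\<B>" "edges H = C \<union> R'" "ends H = ends G" by (simp_all add: H_def)
  have UV: "\<Union>\<B> \<subseteq> vertices G" using clique_modelD(1)[OF M] by blast
  have sub: "subgraph H G"
    using G UV R'(2) unfolding subgraph_def graph_def H C_def by (auto intro: finite_subset)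
  have disj: "C \<inter> R' = {}"
  proof (rule equals0I)
    fix e assume e: "e \<in> C \<inter> R'"
    then obtain B where B: "B \<in> \<B>" "ends G e \<subseteq> B" unfolding C_def by blast
    then have "?p e \<subseteq> {B}" using b[OF B(1)] by blast
    then have "card (?p e) \<le> card {B}" by (intro card_mono) auto
    moreover have "card (?p e) = 2" using e R'(3) unfolding bij_betw_def by blast
    ultimately show False by simp
  qed
  have comp: "component H C x = ?b x" if x: "x \<in> \<Union>\<B>" for x
  proof (intro equalityI subsetI)
    fix w assume "w \<in> component H C x"
    then have "(x, w) \<in> (joined_by H C)\<^sup>*" unfolding component_def by blast
    then show "w \<in> ?b x"
    proof (induction rule: rtrancl_induct)
      case base
      then show ?case using bm(2)[OF x] .
    next
      case (step p q)
      then obtain e B where "B \<in> \<B>" "p \<in> B" "q \<in> B"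
        unfolding joined_by_def H C_def by auto
      moreover from this have "B = ?b x"
        using clique_model_disjoint[OF M _ bm(1)[OF x] _ step(3)] by blast
      ultimately show ?case by simp
    qed
  next
    fix w assume w: "w \<in> ?b x"
    let ?W = "{y \<in> ?b x. (x, y) \<in> (joined_by H C)\<^sup>*}"
    have "?W = ?b x"
    proof (rule ccontr)
      assume "?W \<noteq> ?b x"
      then have W: "?W \<subset> ?b x" "?W \<noteq> {}" using bm(2)[OF x] by blast+
      obtain p q where pq: "p \<in> ?W" "q \<in> ?b x - ?W" "(p, q) \<in> ?E"
        by (rule connD[OF clique_modelD(2)[OF M bm(1)[OF x]] W])
      then obtain e where e: "e \<in> edges G" "ends G e = {p, q}" unfolding joined_by_def by blast
      then have "e \<in> C" using pq(1,2) bm(1)[OF x] unfolding C_def by auto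
      then have "(p, q) \<in> joined_by H C" using e(2) unfolding joined_by_def H by blast
      then show False using pq by (auto intro: rtrancl_into_rtrancl)
    qed
    then show "w \<in> component H C x" using w bm(1)[OF x] unfolding component_def H by blast
  qed
  define N where "N = contract H C"
  have EN: "edges N = R'" unfolding N_def contract_def H using disj by auto
  have VN: "vertices N = \<B>"
  proof -
    have "vertices N = ?b ` \<Union>\<B>" unfolding N_def contract_def H using comp by auto
    also have "\<dots> = \<B>"
    proof (intro equalityI subsetI)
      fix B assume B: "B \<in> \<B>"
      then obtain x where "x \<in> B" using clique_modelD(3)[OF M] by blast
      then show "B \<in> ?b ` \<Union>\<B>" using b[OF B] B by blast
    qed (use bm(1) in auto)
    finally show ?thesis .
  qed
  have dN: "ends N e = ?p e" if "e \<in> edges N" for e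
  proof -
    have "ends G e \<subseteq> \<Union>\<B>" using that EN R'(2) by blast
    then have "component H C ` ends G e = ?b ` ends G e" using comp by (intro image_cong) auto
    then show ?thesis unfolding N_def contract_def H by simp
  qed
  obtain f where f: "bij_betw f \<B> {..<card \<B>}"
    using ex_bij_betw_finite_nat[OF fin] by (auto simp: atLeast0LessThan)
  \<comment> \<open>An edge of \<open>complete_graph\<close> is its own set of ends, so the
    numbering \<open>f\<close> of the branch sets dictates the map on edges.\<close>
  have "bij_betw ((`) f \<circ> ?p) (edges N) (edges (complete_graph (card \<B>)))"
    unfolding EN complete_graph_def using bij_betw_trans[OF R'(3) bij_betw_pairs[OF f]] by simp
  then have "isomorphic N (complete_graph (card \<B>))"
    unfolding isomorphic_def VN using f dN
    by (intro exI[of _ f] exI[of _ "(`) f \<circ> ?p"]) (simp add: complete_graph_def)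
  moreover have "minor N G" unfolding minor_def N_def using sub H(2) by blast
  ultimately show ?thesis using VN EN R'(1) dN by blast
qed

theorem theorem1p4:
  fixes G T :: "('v, 'e) multigraph"
  assumes "graph G"
    and "k_connected 3 G"
    and "triangle T G"
    and "\<exists>N. minor N G \<and> isomorphic N (complete_graph 5)"
  shows "\<exists>N. minor N G \<and> isomorphic N (complete_graph 5) \<and>
           (\<exists>T'. triangle T' N \<and> edges T' = edges T)"
proof -
  let ?E = "joined_by G (edges G)" and ?V = "vertices G"
  obtain a b c d e f where T: "distinct [a, b, c]" "distinct [d, e, f]" "edges T = {d, e, f}"
      "{a, b, c} \<subseteq> ?V" "{d, e, f} \<subseteq> edges G"
      "ends G d = {a, b}" "ends G e = {b, c}" "ends G f = {c, a}"
    by (rule triangleE[OF assms(3)])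
  obtain \<B> where B: "clique_model ?E ?V \<B>" "card \<B> = 5"
    using clique_model_of_minor[OF assms(1)] assms(4) by blast
  have card: "card {a, b, c} = 3" using T(1) by simp
  have t: "tied ?E ?V {a, b, c} \<B>"
    using tied_of_k_connected[OF assms(1) _ T(4) B(1)] assms(2) card by simp
  have "(a, b) \<in> ?E" "(b, c) \<in> ?E" "(c, a) \<in> ?E"
    using T(5-8) unfolding joined_by_def by auto
  then have tri: "(x, y) \<in> ?E" if "x \<in> {a, b, c}" "y \<in> {a, b, c}" "x \<noteq> y" for x y
    using that symD[OF sym_joined_by[of G "edges G"]] by (elim insertE emptyE) simp_all
  have "finite ?V" using assms(1) by (simp add: graph_def)
  then obtain \<D> where D: "clique_model ?E ?V \<D>" "card \<D> = 5" "rooted {a, b, c} \<D>"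
    using rooted_K5_model[OF _ joined_by_vertices[OF assms(1) subset_refl] sym_joined_by T(4) card tri B t]
    by blast
  let ?b = "branch_of \<D>"
  have b: "?b x \<in> \<D> \<and> x \<in> ?b x" if x: "x \<in> {a, b, c}" for x
  proof -
    obtain B where "B \<in> \<D>" "x \<in> B" using D(3) x unfolding rooted_def by blast
    then show ?thesis using branch_of_eq[OF D(1)] by simp
  qed
  have "?b x \<noteq> ?b y" if "x \<in> {a, b, c}" "y \<in> {a, b, c}" "x \<noteq> y" for x y
    using D(3) b[OF that(1)] b[OF that(2)] that unfolding rooted_def by (metis IntI)
  then have dist: "distinct [?b a, ?b b, ?b c]" using T(1) by simp
  have p: "?b ` ends G d = {?b a, ?b b}" "?b ` ends G e = {?b b, ?b c}" "?b ` ends G f = {?b c, ?b a}"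
    using T(6-8) by simp_all
  \<comment> \<open>The roots lie in different branch sets, so the three triangle edges represent
    three different pairs; this is what allows prescribing them all.\<close>
  have "distinct [?b ` ends G d, ?b ` ends G e, ?b ` ends G f]"
    unfolding p using dist by (auto simp: doubleton_eq_iff)
  then have inj: "inj_on (\<lambda>e. ?b ` ends G e) (edges T)"
    unfolding T(3) inj_on_def by fastforce
  have sub: "ends G h \<subseteq> \<Union>\<D>" if "h \<in> edges T" for h
    using that T(6-8) b[of a] b[of b] b[of c] unfolding T(3) by auto
  have two: "card (?b ` ends G h) = 2" if "h \<in> edges T" for h
    using that p dist unfolding T(3) by (elim insertE emptyE) (auto simp: card_insert_if)
  have TG: "edges T \<subseteq> edges G" using T(3,5) by simp
  have fin: "finite \<D>" using D(2) by (simp add: card_ge_0_finite)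
  obtain N where N: "minor N G" "isomorphic N (complete_graph 5)" "vertices N = \<D>"
      "edges T \<subseteq> edges N" "\<forall>h\<in>edges N. ends N h = ?b ` ends G h"
    using minor_of_clique_model[OF assms(1) D(1) fin TG sub inj two] unfolding D(2) by blast
  have "ends N d = {?b a, ?b b}" "ends N e = {?b b, ?b c}" "ends N f = {?b c, ?b a}"
    using N(4,5) T(3) p by simp_all
  then have "triangle \<lparr>vertices = {?b a, ?b b, ?b c}, edges = {d, e, f}, ends = ends N\<rparr> N"
    using N(3,4) b T(3) by (intro triangleI[OF dist T(2)]) auto
  then show ?thesis using N(1,2) T(3)
    by (intro exI[of _ N] conjI exI[of _ "\<lparr>vertices = {?b a, ?b b, ?b c}, edges = {d, e, f}, ends = ends N\<rparr>"])
       simp_all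
qed

end
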